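(* Let $\{V_n;\,n\ge1\}$ be independent $\mathbf B$-valued random variables and $\{a_n;\,n\ge1\}$ nonnegative reals with $\sum_n a_n<\infty$. Set $b_n=\sum_{i=n}^\infty a_i$, $T_n=\sum_{i=1}^nV_i$, $N=\sup_{n\ge1}b_n\|V_n\|$, $L=\sum_{n=1}^\infty a_n\|T_n\|$, $M=\sum_{n=1}^\infty b_n\|V_n\|$, and $\Gamma(t)=\sum_{n=1}^\infty\mathbb P(b_n\|V_n\|>t)$ for $t\ge0$. Then $L\le M$. Suppose moreover that $\sup_{n\ge1}\mathbb P(b_n\|V_n\|>a)<1$ for some $a\ge0$. Then: (a) $L<\infty$ a.s. implies $N<\infty$ a.s.; and $N<\infty$ a.s. if and only if $\inf_{r\ge0}\Gamma(r)<\infty$. (b) $\mathbb EN<\infty$ if and only if $\int_r^\infty\Gamma(t)\,dt<\infty$ for some $r\ge0$. (c) $\mathbb EL<\infty$ if and only if ($L<\infty$ a.s. and $\mathbb EN<\infty$). (d) If $\mathbb EL<\infty$, then $\mathbb E\|V_n\|<\infty$ for every $n$ with $b_n>0$, and $b_n\,\mathbb E\|T_n-\mathbb ET_n\|\to0$ as $n\to\infty$ (terms with $b_n=0$ being interpreted as $0$). (e) If $\sum_{n=1}^\infty b_n=\infty$ and $L<\infty$ a.s., then $\liminf_{n\to\infty}\|T_n\|/n=0$ a.s.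
   Context: $(\mathbf{B},\|\cdot\|)$ is a real separable Banach space with its Borel $\sigma$-algebra. $\mathbb{E}$ of a $\mathbf B$-valued random variable denotes the Pettis integral (which exists whenever $\mathbb E\|\cdot\|<\infty$). *)

theory Defs
  imports "HOL-Probability.Probability"
begin

text \<open>Tail sums b_n = sum_{i>=n} a_i (sequence a indexed from 1).\<close>
definition tailsum :: "(nat \<Rightarrow> real) \<Rightarrow> nat \<Rightarrow> real" where
  "tailsum a n = (\<Sum>i. a (n + i))"

definition psum :: "(nat \<Rightarrow> 'a \<Rightarrow> 'b::real_normed_vector) \<Rightarrow> nat \<Rightarrow> 'a \<Rightarrow> 'b" where
  "psum V n \<omega> = (\<Sum>i\<in>{1..n}. V i \<omega>)"

definition supN :: "(nat \<Rightarrow> real) \<Rightarrow> (nat \<Rightarrow> 'a \<Rightarrow> 'b::real_normed_vector) \<Rightarrow> 'a \<Rightarrow> ennreal" where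
  "supN a V \<omega> = (SUP n\<in>{1..}. ennreal (tailsum a n * norm (V n \<omega>)))"

definition sumL :: "(nat \<Rightarrow> real) \<Rightarrow> (nat \<Rightarrow> 'a \<Rightarrow> 'b::real_normed_vector) \<Rightarrow> 'a \<Rightarrow> ennreal" where
  "sumL a V \<omega> = (\<Sum>n. ennreal (a (Suc n) * norm (psum V (Suc n) \<omega>)))"

definition sumM :: "(nat \<Rightarrow> real) \<Rightarrow> (nat \<Rightarrow> 'a \<Rightarrow> 'b::real_normed_vector) \<Rightarrow> 'a \<Rightarrow> ennreal" where
  "sumM a V \<omega> = (\<Sum>n. ennreal (tailsum a (Suc n) * norm (V (Suc n) \<omega>)))"

definition Gam :: "'a measure \<Rightarrow> (nat \<Rightarrow> real) \<Rightarrow> (nat \<Rightarrow> 'a \<Rightarrow> 'b::real_normed_vector) \<Rightarrow> real \<Rightarrow> ennreal" where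
  "Gam M a V t = (\<Sum>n. ennreal (measure M {\<omega>\<in>space M. tailsum a (Suc n) * norm (V (Suc n) \<omega>) > t}))"

end

theory Submission
  imports Defs
begin

text \<open>
  \<open>L\<close> is the norm, in the space of \<open>\<^bold>B\<close>-valued sequences with weights \<open>a\<close>, of the
  sum of the independent vectors \<open>X\<^sub>k = (0, \<dots>, 0, V\<^sub>k, V\<^sub>k, \<dots>)\<close>, whose norms are \<open>b\<^sub>k\<parallel>V\<^sub>k\<parallel>\<close>.
  The statements about \<open>N\<close> and \<open>\<Gamma>\<close> rest on \<open>\<Gamma>(t) P(N \<le> t) \<le> P(N > t) \<le> \<Gamma>(t)\<close>.
  To compare \<open>L\<close> with \<open>N\<close>, symmetrize with an independent copy: for the symmetric sequence,
  Levy's inequality bounds the maximal partial sum (hence \<open>N\<close>) by \<open>L\<close>, and the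
  Hoffmann-Jorgensen inequality bounds its mean in terms of that of \<open>N\<close>. The hypothesis on
  \<open>P(b\<^sub>n\<parallel>V\<^sub>n\<parallel> > c)\<close> transfers tail bounds from the symmetrized \<open>\<Gamma>\<close> back to \<open>\<Gamma>\<close>.
\<close>

text \<open>\<open>L\<close> is read through \<open>seqL\<close>, a function of a deterministic
  sequence, so that triangle inequalities, blocks and reflections are pointwise facts and Levy's
  inequality only involves the joint law. The hypothesis bounds the variables b_n||V_n|| one index
  at a time; it is therefore applied to each summand of \<Gamma>, and the two-sided comparison of
  \<Gamma> with the tail of \<open>N\<close> carries the result over to \<open>N\<close>. The
  integrated Hoffmann-Jorgensen inequality has the unknown mean on both sides and can be solved for
  it only when it is finite, so it is proved for bounded truncations and passed to the limit. Parts
  (d) and (e) use that b_n is the sum of the a_k with k >= n. For (d), the centered means E||T_n - E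
  T_n|| increase with n, so b_n times the n-th one is at most a tail of the series of a_k E||T_k - E
  T_k||. For (e), exchanging sums turns the sum of the b_n into the sum of the n a_n, which
  converges if ||T_n|| has a linear lower bound and L is finite.\<close>

definition seqL :: "(nat \<Rightarrow> real) \<Rightarrow> (nat \<Rightarrow> 'b::real_normed_vector) \<Rightarrow> ennreal" where
  "seqL a w = (\<Sum>n. ennreal (a (Suc n) * norm (\<Sum>i\<in>{1..Suc n}. w i)))"

text \<open>The value of \<open>L\<close> on the block \<open>(k, j]\<close> of the sequence, i.e. the norm of \<open>X\<^sub>k\<^sub>+\<^sub>1 + \<dots> + X\<^sub>j\<close>.\<close>

definition blk :: "(nat \<Rightarrow> real) \<Rightarrow> nat \<Rightarrow> nat \<Rightarrow> (nat \<Rightarrow> 'b::real_normed_vector) \<Rightarrow> ennreal" where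
  "blk a k j w = seqL a (\<lambda>i. if k < i \<and> i \<le> j then w i else 0)"

lemma seqL_cong: "(\<And>i. 1 \<le> i \<Longrightarrow> v i = w i) \<Longrightarrow> seqL a v = seqL a w"
  unfolding seqL_def by (intro suminf_cong arg_cong[where f=ennreal] arg_cong2[where f="(*)"] refl
      arg_cong[where f=norm] sum.cong) auto

lemma blk_cong: "(\<And>i. k < i \<Longrightarrow> i \<le> j \<Longrightarrow> v i = w i) \<Longrightarrow> blk a k j v = blk a k j w"
  unfolding blk_def by (intro seqL_cong) auto

lemma blk_eq_0: "j \<le> k \<Longrightarrow> blk a k j w = 0"
proof -
  assume "j \<le> k"
  then have "(\<lambda>i. if k < i \<and> i \<le> j then w i else 0) = (\<lambda>_. 0)" by (auto simp: fun_eq_iff)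
  then show ?thesis by (simp add: blk_def seqL_def)
qed

lemma sumL_eq_seqL: "sumL a V \<omega> = seqL a (\<lambda>i. V i \<omega>)"
  by (simp add: sumL_def seqL_def psum_def)

lemma seqL_uminus: "seqL a (\<lambda>i. - w i) = seqL a w"
  by (simp only: seqL_def sum_negf norm_minus_cancel)

section \<open>Pointwise inequalities for the weighted norm and its blocks\<close>

locale weights =
  fixes a :: "nat \<Rightarrow> real"
  assumes a_nonneg: "\<And>n. n \<ge> 1 \<Longrightarrow> a n \<ge> 0"
    and a_summable: "summable (\<lambda>n. a (Suc n))"
begin

lemma summable_tail: "n \<ge> 1 \<Longrightarrow> summable (\<lambda>i. a (n + i))"
  using summable_ignore_initial_segment[OF a_summable, of "n - 1"] by (simp add: add.commute)

lemma tailsum_nonneg: "n \<ge> 1 \<Longrightarrow> tailsum a n \<ge> 0"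
  unfolding tailsum_def by (intro suminf_nonneg summable_tail a_nonneg) auto

lemma tailsum_ge_term: "n \<ge> 1 \<Longrightarrow> n \<le> k \<Longrightarrow> a k \<le> tailsum a n"
  unfolding tailsum_def
  using sum_le_suminf[OF summable_tail, of n "{k - n}"] a_nonneg by auto

lemma tailsum_antimono:
  assumes "n \<ge> 1" "n \<le> k"
  shows "tailsum a k \<le> tailsum a n"
proof -
  have "tailsum a n = (\<Sum>i. a (k + i)) + (\<Sum>i<k-n. a (n + i))"
    unfolding tailsum_def
    using suminf_split_initial_segment[OF summable_tail[OF assms(1)], of "k-n"] assms
    by (simp add: algebra_simps)
  moreover have "(\<Sum>i<k-n. a (n + i)) \<ge> 0" using assms by (intro sum_nonneg a_nonneg) auto
  ultimately show ?thesis by (simp add: tailsum_def)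
qed

lemma seqL_add: "seqL a (\<lambda>i. v i + w i) \<le> seqL a v + seqL a w"
  unfolding seqL_def
proof (subst suminf_add, simp, simp, intro suminf_le summableI)
  fix n
  have "a (Suc n) * norm (\<Sum>i\<in>{1..Suc n}. v i + w i)
     \<le> a (Suc n) * norm (\<Sum>i\<in>{1..Suc n}. v i) + a (Suc n) * norm (\<Sum>i\<in>{1..Suc n}. w i)"
    unfolding sum.distrib distrib_left[symmetric]
    by (intro mult_left_mono norm_triangle_ineq a_nonneg) auto
  then show "ennreal (a (Suc n) * norm (\<Sum>i\<in>{1..Suc n}. v i + w i)) \<le>
     ennreal (a (Suc n) * norm (\<Sum>i\<in>{1..Suc n}. v i)) + ennreal (a (Suc n) * norm (\<Sum>i\<in>{1..Suc n}. w i))"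
    by (subst ennreal_plus[symmetric]) (auto intro!: ennreal_leI mult_nonneg_nonneg a_nonneg)
qed

lemma seqL_diff: "seqL a (\<lambda>i. v i - w i) \<le> seqL a v + seqL a w"
  using seqL_add[of v "\<lambda>i. - w i"] by (simp add: seqL_uminus)

lemma seqL_double: "seqL a (\<lambda>i. w i + w i) = 2 * seqL a w"
proof -
  have *: "norm (\<Sum>i\<in>A. w i + w i) = 2 * norm (\<Sum>i\<in>A. w i)" for A
    by (simp add: scaleR_2[symmetric] scaleR_right.sum[symmetric])
  have "seqL a (\<lambda>i. w i + w i) = (\<Sum>n. 2 * ennreal (a (Suc n) * norm (\<Sum>i\<in>{1..Suc n}. w i)))"
    unfolding seqL_def *
    by (intro suminf_cong, subst ennreal_numeral[symmetric], subst ennreal_mult[symmetric])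
       (auto simp: mult_ac a_nonneg)
  then show ?thesis by (simp add: seqL_def)
qed

lemma blk_triangle: "k \<le> l \<Longrightarrow> l \<le> j \<Longrightarrow> blk a k j w \<le> blk a k l w + blk a l j w"
  unfolding blk_def by (rule order_trans[OF eq_refl seqL_add]) (auto intro!: seqL_cong)

lemma blk_diff_le: "l \<le> j \<Longrightarrow> blk a l j w \<le> blk a 0 j w + blk a 0 l w"
  unfolding blk_def by (rule order_trans[OF eq_refl seqL_diff]) (auto intro!: seqL_cong)

text \<open>Adding a sequence to its reflection after \<open>k\<close> doubles the entries up to
  \<open>k\<close> and cancels the others. An initial block can therefore be large only if
  \<open>seqL\<close> is large for the sequence or for its reflection.\<close>

lemma blk_reflect: 
  "2 * blk a 0 k w \<le> seqL a w + seqL a (\<lambda>i. if k < i then - w i else w i)"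
  unfolding blk_def seqL_double[symmetric]
  by (rule order_trans[OF eq_refl seqL_add]) (auto intro!: seqL_cong)

text \<open>The partial sums vanish up to index \<open>k\<close> and equal \<open>w (Suc k)\<close>
  from then on, so the norm collects all weights from \<open>Suc k\<close> on. This is how the tail
  sums b_n enter.\<close>

lemma blk_single: "blk a k (Suc k) w = ennreal (tailsum a (Suc k) * norm (w (Suc k)))"
proof -
  have *: "(\<Sum>i\<in>{1..Suc n}. if k < i \<and> i \<le> Suc k then w i else 0) = (if k \<le> n then w (Suc k) else 0)" for n
  proof -
    have "(\<Sum>i\<in>{1..Suc n}. if k < i \<and> i \<le> Suc k then w i else 0) 
       = (\<Sum>i\<in>{1..Suc n}. if i = Suc k then w i else 0)"
      by (intro sum.cong) auto
    also have "\<dots> = (if k \<le> n then w (Suc k) else 0)" by (subst sum.delta) auto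
    finally show ?thesis .
  qed
  have "blk a k (Suc k) w = (\<Sum>n. ennreal (a (Suc n) * norm (if k \<le> n then w (Suc k) else 0)))"
    unfolding blk_def seqL_def * ..
  also have "\<dots> = (\<Sum>n. ennreal (a (Suc (n+k)) * norm (w (Suc k))))"
    by (subst suminf_offset[where i=k]) auto
  also have "\<dots> = ennreal (\<Sum>n. a (Suc (n+k)) * norm (w (Suc k)))"
    using summable_tail[of "Suc k"]
    by (intro suminf_ennreal2) (auto intro!: summable_mult2 mult_nonneg_nonneg a_nonneg simp: add.commute)
  also have "(\<Sum>n. a (Suc (n+k)) * norm (w (Suc k))) = tailsum a (Suc k) * norm (w (Suc k))"
    unfolding tailsum_def using summable_tail[of "Suc k"] 
    by (subst suminf_mult2) (auto simp: add.commute)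
  finally show ?thesis .
qed

text \<open>The first \<open>n\<close> terms of the series read only entries up to \<open>n\<close>,
  so they do not change when the later entries are set to 0. The supremum can be much larger than
  \<open>seqL a w\<close> because later entries may cancel earlier ones.\<close>

lemma seqL_le_SUP_blk: "seqL a w \<le> (SUP j. blk a 0 j w)"
  unfolding seqL_def suminf_eq_SUP
proof (rule SUP_mono)
  fix n :: nat
  have "(\<Sum>i<n. ennreal (a (Suc i) * norm (\<Sum>i\<in>{1..Suc i}. w i)))
     = (\<Sum>i<n. ennreal (a (Suc i) * norm (\<Sum>i\<in>{1..Suc i}. if 0 < i \<and> i \<le> n then w i else 0)))"
    by (intro sum.cong arg_cong[where f=ennreal] arg_cong2[where f="(*)"] refl
      arg_cong[where f=norm] sum.cong) auto
  also have "\<dots> \<le> blk a 0 n w"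
    unfolding blk_def seqL_def by (intro sum_le_suminf) auto
  finally show "\<exists>m\<in>UNIV. (\<Sum>i<n. ennreal (a (Suc i) * norm (\<Sum>i\<in>{1..Suc i}. w i))) \<le> blk a 0 m w" by auto
qed

lemma blk_le_sum: "blk a 0 j w \<le> (\<Sum>k<j. ennreal (tailsum a (Suc k) * norm (w (Suc k))))"
proof (induction j)
  case (Suc j)
  then show ?case
    using blk_triangle[of 0 j "Suc j" w] by (auto simp: blk_single intro: order_trans add_right_mono)
qed (simp add: blk_eq_0)

lemma sumL_le_sumM: "sumL a V \<omega> \<le> sumM a V \<omega>"
proof -
  have "blk a 0 j w \<le> (\<Sum>k. ennreal (tailsum a (Suc k) * norm (w (Suc k))))" for j and w :: "nat \<Rightarrow> 'c::real_normed_vector"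
    by (rule order_trans[OF blk_le_sum sum_le_suminf]) auto
  then show ?thesis unfolding sumL_eq_seqL sumM_def
    by (intro order_trans[OF seqL_le_SUP_blk] SUP_least)
qed

text \<open>One entry is the difference of two consecutive initial blocks, hence the factor
  2.\<close>

lemma term_le_blk: "ennreal (tailsum a (Suc k) * norm (w (Suc k))) \<le> 2 * (SUP j. blk a 0 j w)"
proof -
  have "blk a k (Suc k) w \<le> blk a 0 (Suc k) w + blk a 0 k w" by (rule blk_diff_le) simp
  also have "\<dots> \<le> (SUP j. blk a 0 j w) + (SUP j. blk a 0 j w)" by (intro add_mono SUP_upper) auto
  finally show ?thesis by (simp add: blk_single mult_2)
qed

lemma supN_le_blk: "supN a V \<omega> \<le> 2 * (SUP j. blk a 0 j (\<lambda>i. V i \<omega>))"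
  unfolding supN_def
proof (rule SUP_least)
  fix n :: nat assume "n \<in> {1..}"
  then show "ennreal (tailsum a n * norm (V n \<omega>)) \<le> 2 * (SUP j. blk a 0 j (\<lambda>i. V i \<omega>))"
    using term_le_blk[of "n-1" "\<lambda>i. V i \<omega>"] by simp
qed

end

section \<open>Measurability and the layer cake formula\<close>

lemma seqL_measurable [measurable]:
  fixes X :: "nat \<Rightarrow> 'a \<Rightarrow> 'b::{banach, second_countable_topology}"
  assumes "\<And>i. 1 \<le> i \<Longrightarrow> X i \<in> borel_measurable M"
  shows "(\<lambda>x. seqL a (\<lambda>i. X i x)) \<in> borel_measurable M"
  unfolding seqL_def
proof (rule borel_measurable_suminf_order)
  fix n
  have [measurable]: "(\<lambda>x. \<Sum>i\<in>{1..Suc n}. X i x) \<in> borel_measurable M"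
    by (rule borel_measurable_sum) (auto intro: assms)
  show "(\<lambda>x. ennreal (a (Suc n) * norm (\<Sum>i\<in>{1..Suc n}. X i x))) \<in> borel_measurable M"
    by measurable
qed

lemma blk_measurable:
  fixes X :: "nat \<Rightarrow> 'a \<Rightarrow> 'b::{banach, second_countable_topology}"
  assumes "\<And>i. k < i \<Longrightarrow> i \<le> j \<Longrightarrow> X i \<in> borel_measurable M"
  shows "(\<lambda>x. blk a k j (\<lambda>i. X i x)) \<in> borel_measurable M"
  unfolding blk_def
proof (rule seqL_measurable)
  fix i show "(\<lambda>x. if k < i \<and> i \<le> j then X i x else 0) \<in> borel_measurable M"
    using assms by (cases "k < i \<and> i \<le> j") auto
qed

text \<open>Tonelli for the indicator of the region below the graph of \<open>f\<close>. Infinite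
  values are allowed, so \<open>lev\<close> also has to know that the half-line has infinite
  measure. This formula turns the tail inequalities below into inequalities between means.\<close>

lemma nn_integral_layer_cake:
  fixes f :: "'a \<Rightarrow> ennreal"
  assumes "sigma_finite_measure M" and f [measurable]: "f \<in> borel_measurable M"
  shows "(\<integral>\<^sup>+x. f x \<partial>M) = (\<integral>\<^sup>+t\<in>{0<..}. emeasure M {x\<in>space M. ennreal t < f x} \<partial>lborel)"
proof -
  interpret sigma_finite_measure M by fact
  interpret pair_sigma_finite M lborel ..
  have lev: "(\<integral>\<^sup>+t. indicator {t. 0 < t \<and> ennreal t < c} t \<partial>lborel) = c" for c :: ennreal
  proof (cases c)
    case (real r)
    have "{t. 0 < t \<and> ennreal t < c} = {0<..<r}"
      using real by (auto simp: ennreal_less_iff)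
    then show ?thesis using real by simp
  next
    case top
    have "{t. 0 < t \<and> ennreal t < c} = {0::real<..}" using top by auto
    moreover have "emeasure lborel {0::real<..} = \<infinity>"
    proof (rule ccontr)
      assume "emeasure lborel {0::real<..} \<noteq> \<infinity>"
      then obtain r where r: "emeasure lborel {0::real<..} = ennreal r" "r \<ge> 0"
        by (cases "emeasure lborel {0::real<..}") auto
      have "emeasure lborel {0<..<r+1} \<le> emeasure lborel {0::real<..}"
        by (rule emeasure_mono) auto
      then show False using r by simp
    qed
    ultimately show ?thesis using top by simp
  qed
  have [measurable]: "Measurable.pred (M \<Otimes>\<^sub>M lborel) (\<lambda>(x, t). 0 < t \<and> ennreal t < f x)"
    by measurable
  have "(\<integral>\<^sup>+x. f x \<partial>M) = (\<integral>\<^sup>+x. (\<integral>\<^sup>+t. indicator {(x,t). 0 < t \<and> ennreal t < f x} (x, t) \<partial>lborel) \<partial>M)"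
  proof (intro nn_integral_cong)
    fix x
    have "f x = (\<integral>\<^sup>+t. indicator {t. 0 < t \<and> ennreal t < f x} t \<partial>lborel)" by (simp only: lev)
    also have "\<dots> = (\<integral>\<^sup>+t. indicator {(x,t). 0 < t \<and> ennreal t < f x} (x, t) \<partial>lborel)"
      by (intro nn_integral_cong) (simp add: indicator_def)
    finally show "f x = (\<integral>\<^sup>+t. indicator {(x,t). 0 < t \<and> ennreal t < f x} (x, t) \<partial>lborel)" .
  qed
  also have "\<dots> = (\<integral>\<^sup>+t. (\<integral>\<^sup>+x. indicator {(x,t). 0 < t \<and> ennreal t < f x} (x, t) \<partial>M) \<partial>lborel)"
    by (subst Fubini') (auto simp: split_beta')
  also have "\<dots> = (\<integral>\<^sup>+t\<in>{0<..}. emeasure M {x\<in>space M. ennreal t < f x} \<partial>lborel)"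
  proof (intro nn_integral_cong)
    fix t :: real
    have "(\<integral>\<^sup>+x. indicator {(x,t). 0 < t \<and> ennreal t < f x} (x, t) \<partial>M)
      = (\<integral>\<^sup>+x. indicator {x\<in>space M. ennreal t < f x} x * indicator {0<..} t \<partial>M)"
      by (intro nn_integral_cong) (auto simp: indicator_def)
    also have "\<dots> = emeasure M {x\<in>space M. ennreal t < f x} * indicator {0<..} t"
      by (subst nn_integral_multc) auto
    finally show "(\<integral>\<^sup>+x. indicator {(x,t). 0 < t \<and> ennreal t < f x} (x, t) \<partial>M) = emeasure M {x\<in>space M. ennreal t < f x} * indicator {0<..} t" .
  qed
  finally show ?thesis .
qed

section \<open>Tails of the supremum of independent variables\<close>

text \<open>For independent events of probabilities \<open>p i\<close>, the left side is at most the
  probability that exactly one of the first \<open>n\<close> occurs (putting in the extra factor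
  \<open>1 - p i\<close> only decreases each summand), and the right side is the probability that at
  least one occurs.\<close>

lemma prod_compl_mult_sum_le:
  fixes p :: "nat \<Rightarrow> real"
  assumes "\<And>i. 0 \<le> p i" "\<And>i. p i \<le> 1"
  shows "(\<Prod>i<n. 1 - p i) * (\<Sum>i<n. p i) \<le> 1 - (\<Prod>i<n. 1 - p i)"
proof (induction n)
  case (Suc n)
  define Q S where "Q = (\<Prod>i<n. 1 - p i)" and "S = (\<Sum>i<n. p i)"
  have Q: "0 \<le> Q" "Q \<le> 1" unfolding Q_def using assms by (auto intro!: prod_nonneg prod_le_1)
  have "(Q * (1 - p n)) * (S + p n) = (1 - p n) * (Q * S) + p n * Q * (1 - p n)"
    by (simp add: algebra_simps)
  also have "\<dots> \<le> (1 - p n) * (1 - Q) + p n * Q * (1 - p n)"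
    using Suc assms[of n] unfolding Q_def S_def by (intro add_right_mono mult_left_mono) auto
  also have "\<dots> = 1 - Q * (1 - p n) - p n * (1 - Q) - p n * p n * Q"
    by (simp add: algebra_simps)
  also have "\<dots> \<le> 1 - Q * (1 - p n)"
    using Q assms[of n] by (smt (verit) mult_nonneg_nonneg)
  finally show ?case by (simp add: Q_def S_def)
qed simp

lemma measurable_Gam_event:
  assumes "V \<in> borel_measurable M"
  shows "{\<omega>\<in>space M. c * norm (V \<omega>) > t} \<in> sets M"
  using assms by measurable

lemma supN_measurable:
  assumes "\<And>n. n \<ge> 1 \<Longrightarrow> V n \<in> borel_measurable M"
  shows "supN a V \<in> borel_measurable M"
  unfolding supN_def
proof (rule borel_measurable_SUP)
  fix n :: nat assume "n \<in> {1..}"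
  then have [measurable]: "V n \<in> borel_measurable M" using assms by simp
  show "(\<lambda>\<omega>. ennreal (tailsum a n * norm (V n \<omega>))) \<in> borel_measurable M" by measurable
qed simp

lemma supN_gt_iff: "t < supN a V \<omega> \<longleftrightarrow> (\<exists>n. t < ennreal (tailsum a (Suc n) * norm (V (Suc n) \<omega>)))"
proof -
  have "{1..} = range Suc" by (auto simp: image_iff Suc_le_eq gr0_conv_Suc)
  then show ?thesis unfolding supN_def less_SUP_iff by auto
qed

context weights begin

lemma ennreal_less_term_iff:
  "0 \<le> t \<Longrightarrow> ennreal t < ennreal (tailsum a (Suc n) * norm x) \<longleftrightarrow> t < tailsum a (Suc n) * norm x"
  by (simp add: ennreal_less_iff)

lemma emeasure_supN_le_Gam:
  assumes "prob_space M" "\<And>n. n \<ge> 1 \<Longrightarrow> V n \<in> borel_measurable M" "0 \<le> t"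
  shows "emeasure M {\<omega>\<in>space M. ennreal t < supN a V \<omega>} \<le> Gam M a V t"
proof -
  interpret prob_space M by fact
  let ?A = "\<lambda>n. {\<omega>\<in>space M. tailsum a (Suc n) * norm (V (Suc n) \<omega>) > t}"
  have "emeasure M {\<omega>\<in>space M. ennreal t < supN a V \<omega>} = emeasure M (\<Union>n. ?A n)"
    using assms(3) by (intro arg_cong[where f="emeasure M"]) (auto simp: supN_gt_iff ennreal_less_term_iff)
  also have "\<dots> \<le> (\<Sum>n. emeasure M (?A n))"
    using measurable_Gam_event[OF assms(2)] by (intro emeasure_subadditive_countably) auto
  finally show ?thesis by (simp only: Gam_def emeasure_eq_measure)
qed

text \<open>By independence the product of the \<open>1 - p i\<close> with \<open>i < n\<close> is
  the probability that the first \<open>n\<close> terms stay at or below \<open>t\<close>, which is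
  at least P(N \<le> t). Inserting this in \<open>prod_compl_mult_sum_le\<close> bounds every
  partial sum of \<Gamma>(t) times P(N \<le> t).\<close>

lemma Gam_mult_le:
  assumes "prob_space M" "prob_space.indep_vars M (\<lambda>_. borel) V {1..}" "0 \<le> t"
  shows "Gam M a V t * emeasure M {\<omega>\<in>space M. supN a V \<omega> \<le> ennreal t}
    \<le> emeasure M {\<omega>\<in>space M. ennreal t < supN a V \<omega>}"
proof -
  interpret prob_space M by fact
  have V [measurable]: "V n \<in> borel_measurable M" if "n \<ge> 1" for n
    using assms(2) that by (auto simp: indep_vars_def)
  note [measurable] = supN_measurable[OF V]
  let ?A = "\<lambda>n. {\<omega>\<in>space M. tailsum a (Suc n) * norm (V (Suc n) \<omega>) > t}"
  define p where "p n = prob (?A n)" for n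
  have A [measurable]: "?A n \<in> events" for n using measurable_Gam_event[OF V] by simp
  define N where "N = prob {\<omega>\<in>space M. ennreal t < supN a V \<omega>}"
  have N_sets [measurable]: "{\<omega>\<in>space M. ennreal t < supN a V \<omega>} \<in> events" by measurable
  have N_compl: "prob {\<omega>\<in>space M. supN a V \<omega> \<le> ennreal t} = 1 - N"
    unfolding N_def by (subst prob_compl[symmetric]) (auto intro!: arg_cong[where f=prob] simp: not_less)
  have fin: "(\<Prod>i<n. 1 - p i) \<ge> 1 - N" for n
  \<comment> \<open>The product rule for independent variables is stated for nonempty index
    sets.\<close>
  proof (cases "n = 0")
    case False
    let ?X = "\<lambda>i. V i -` {x. tailsum a i * norm x \<le> t} \<inter> space M"
    have "1 - N \<le> prob (\<Inter>i\<in>Suc ` {..<n}. ?X i)"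
      unfolding N_compl[symmetric]
    proof (rule finite_measure_mono)
      show "{\<omega> \<in> space M. supN a V \<omega> \<le> ennreal t} \<subseteq> (\<Inter>i\<in>Suc ` {..<n}. ?X i)"
        using supN_gt_iff[of "ennreal t" a V] ennreal_less_term_iff[OF assms(3)] by (auto simp flip: not_less)
      show "(\<Inter>i\<in>Suc ` {..<n}. ?X i) \<in> events"
        using False V by (intro sets.finite_INT measurable_sets[OF V]) auto
    qed
    also have "\<dots> = (\<Prod>i\<in>Suc ` {..<n}. prob (?X i))"
      using False by (intro indep_varsD[OF assms(2)]) auto
    also have "\<dots> = (\<Prod>i<n. prob (?X (Suc i)))" by (subst prod.reindex) auto
    also have "\<dots> = (\<Prod>i<n. 1 - p i)"
      unfolding p_def by (intro prod.cong refl, subst prob_compl[OF A, symmetric]) (auto intro!: arg_cong[where f=prob])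
    finally show ?thesis .
  qed (simp add: N_def)
  have p01: "0 \<le> p i" "p i \<le> 1" for i by (auto simp: p_def)
  have N01: "0 \<le> N" "N \<le> 1" by (auto simp: N_def)
  have "Gam M a V t * ennreal (1 - N) = (\<Sum>n. ennreal (p n) * ennreal (1 - N))"
    unfolding Gam_def p_def by (simp add: ennreal_suminf_multc)
  also have "\<dots> = (\<Sum>n. ennreal (p n * (1 - N)))"
    using p01 N01 by (simp add: ennreal_mult)
  also have "\<dots> \<le> ennreal N"
    unfolding suminf_eq_SUP
  proof (rule SUP_least)
    fix n
    have "(\<Sum>i<n. p i * (1 - N)) = (1 - N) * (\<Sum>i<n. p i)" by (simp add: sum_distrib_left mult.commute)
    also have "\<dots> \<le> (\<Prod>i<n. 1 - p i) * (\<Sum>i<n. p i)"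
      using fin p01 by (intro mult_right_mono sum_nonneg)
    also have "\<dots> \<le> 1 - (\<Prod>i<n. 1 - p i)" by (rule prod_compl_mult_sum_le[OF p01])
    also have "\<dots> \<le> N" using fin[of n] by simp
    finally show "(\<Sum>i<n. ennreal (p i * (1 - N))) \<le> ennreal N"
      using p01 N01 by (subst sum_ennreal) (auto intro: ennreal_leI)
  qed
  finally show ?thesis unfolding emeasure_eq_measure N_compl N_def .
qed

end

text \<open>Continuity from above: the events at integer levels decrease to the null event that
  \<open>f\<close> is infinite.\<close>

lemma (in prob_space) AE_finite_imp_tail_le:
  assumes [measurable]: "f \<in> borel_measurable M" and fin: "AE \<omega> in M. f \<omega> < (\<infinity>::ennreal)" and e: "0 < e"
  shows "\<exists>r\<ge>0. \<forall>t\<ge>r. emeasure M {\<omega>\<in>space M. ennreal t < f \<omega>} \<le> ennreal e"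
proof -
  let ?A = "\<lambda>n::nat. {\<omega>\<in>space M. ennreal (real n) < f \<omega>}"
  have "(\<lambda>n. prob (?A n)) \<longlonglongrightarrow> prob (\<Inter>n. ?A n)"
    by (rule finite_Lim_measure_decseq) (auto simp: decseq_def elim!: le_less_trans[rotated] intro!: ennreal_leI)
  moreover have "prob (\<Inter>n. ?A n) = 0"
  proof -
    have "AE \<omega> in M. \<omega> \<notin> (\<Inter>n. ?A n)"
      using fin
    proof eventually_elim
      case (elim \<omega>)
      then obtain r where "f \<omega> = ennreal r" "r \<ge> 0" by (cases "f \<omega>") auto
      moreover obtain n :: nat where "r \<le> real n" using real_arch_simple by blast
      ultimately show ?case by (auto simp: not_less intro!: exI[of _ n] ennreal_leI)
    qed
    then show ?thesis by (subst prob_eq_0) auto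
  qed
  ultimately have "\<forall>\<^sub>F n in sequentially. prob (?A n) < e" using e by (auto dest: order_tendstoD)
  then obtain n where n: "prob (?A n) < e" by (auto simp: eventually_sequentially)
  show ?thesis
  proof (intro exI conjI allI impI)
    fix t assume t: "real n \<le> t"
    have "emeasure M {\<omega>\<in>space M. ennreal t < f \<omega>} \<le> emeasure M (?A n)"
      using t by (intro emeasure_mono) (auto intro: le_less_trans[OF ennreal_leI])
    also have "\<dots> \<le> ennreal e" using n unfolding emeasure_eq_measure by (intro ennreal_leI) simp
    finally show "emeasure M {\<omega>\<in>space M. ennreal t < f \<omega>} \<le> ennreal e" .
  qed simp
qed

section \<open>Finiteness and integrability of \<open>N\<close> in terms of \<Gamma>\<close>

context weights begin

text \<open>Beyond some level \<open>N\<close> stays below \<open>t\<close> with probability at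
  least 1/2, so dividing by that probability in \<open>Gam_mult_le\<close> costs a factor 2.\<close>

lemma Gam_le_two_tail:
  assumes "prob_space M" "prob_space.indep_vars M (\<lambda>_. borel) V {1..}"
    and fin: "AE \<omega> in M. supN a V \<omega> < \<infinity>"
  shows "\<exists>r\<ge>0. \<forall>t\<ge>r. Gam M a V t \<le> 2 * emeasure M {\<omega>\<in>space M. ennreal t < supN a V \<omega>}"
proof -
  interpret prob_space M by fact
  have V: "V n \<in> borel_measurable M" if "n \<ge> 1" for n
    using assms(2) that by (auto simp: indep_vars_def)
  note [measurable] = supN_measurable[OF V]
  obtain r where r: "r \<ge> 0" "\<And>t. t \<ge> r \<Longrightarrow> emeasure M {\<omega>\<in>space M. ennreal t < supN a V \<omega>} \<le> ennreal (1/2)"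
    using AE_finite_imp_tail_le[OF _ fin, of "1/2"] by auto
  show ?thesis
  proof (intro exI[of _ r] conjI allI impI r(1))
    fix t assume t: "r \<le> t"
    let ?N = "{\<omega>\<in>space M. ennreal t < supN a V \<omega>}"
    have "prob {\<omega>\<in>space M. supN a V \<omega> \<le> ennreal t} = 1 - prob ?N"
      by (subst prob_compl[symmetric]) (auto intro!: arg_cong[where f=prob] simp: not_less)
    moreover have "prob ?N \<le> 1/2" using r(2)[OF t] unfolding emeasure_eq_measure
      by (subst (asm) ennreal_le_iff) auto
    ultimately have half: "ennreal (1/2) \<le> emeasure M {\<omega>\<in>space M. supN a V \<omega> \<le> ennreal t}"
      unfolding emeasure_eq_measure by (intro ennreal_leI) linarith
    have "Gam M a V t = 2 * (Gam M a V t * ennreal (1/2))"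
    proof -
      have "2 * ennreal (1/2) = ennreal (2 * (1/2))" by (subst ennreal_mult) auto
      then have "2 * ennreal (1/2) = 1" by simp
      then show ?thesis by (metis mult.left_commute mult.right_neutral)
    qed
    also have "\<dots> \<le> 2 * emeasure M ?N"
      using r(1) t by (intro mult_left_mono order_trans[OF mult_left_mono[OF half] Gam_mult_le] assms) auto
    finally show "Gam M a V t \<le> 2 * emeasure M ?N" .
  qed
qed

text \<open>Forwards, \<Gamma> is at most twice a probability at high levels. Backwards, the
  Borel-Cantelli lemma leaves only finitely many terms above \<open>r\<close>, and each of those is
  finite.\<close>

lemma AE_supN_finite_iff:
  assumes "prob_space M" "prob_space.indep_vars M (\<lambda>_. borel) V {1..}"
  shows "(AE \<omega> in M. supN a V \<omega> < \<infinity>) \<longleftrightarrow> (\<exists>r\<ge>0. Gam M a V r < \<infinity>)"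
proof
  interpret prob_space M by fact
  have V: "V n \<in> borel_measurable M" if "n \<ge> 1" for n
    using assms(2) that by (auto simp: indep_vars_def)
  { assume "AE \<omega> in M. supN a V \<omega> < \<infinity>"
    then obtain r where r: "r \<ge> 0" "Gam M a V r \<le> 2 * emeasure M {\<omega>\<in>space M. ennreal r < supN a V \<omega>}"
      using Gam_le_two_tail[OF assms] by blast
    note r(2)
    also have "2 * emeasure M {\<omega>\<in>space M. ennreal r < supN a V \<omega>} < \<infinity>" by (simp add: ennreal_mult_less_top emeasure_eq_measure)
    finally show "\<exists>r\<ge>0. Gam M a V r < \<infinity>" using r(1) by blast }
  { assume "\<exists>r\<ge>0. Gam M a V r < \<infinity>"
    then obtain r where r: "r \<ge> 0" "Gam M a V r < \<infinity>" by blast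
    let ?A = "\<lambda>n. {\<omega>\<in>space M. tailsum a (Suc n) * norm (V (Suc n) \<omega>) > r}"
    have "AE \<omega> in M. \<forall>\<^sub>F n in sequentially. \<omega> \<in> space M - ?A n"
    proof (rule borel_cantelli_AE1)
      show "?A n \<in> events" for n using measurable_Gam_event[OF V] by simp
      show "summable (\<lambda>n. prob (?A n))"
        using r(2) by (intro summable_suminf_not_top) (auto simp: Gam_def)
    qed (simp add: emeasure_eq_measure)
    then show "AE \<omega> in M. supN a V \<omega> < \<infinity>"
    proof eventually_elim
      case (elim \<omega>)
      then obtain m where m: "\<And>n. n \<ge> m \<Longrightarrow> tailsum a (Suc n) * norm (V (Suc n) \<omega>) \<le> r"
        by (auto simp: eventually_sequentially not_less)
      \<comment> \<open>A bound for all terms at once: \<open>r\<close> covers the indices from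
        \<open>m\<close> on, the sum covers the exceptional ones.\<close>
      define C where "C = r + (\<Sum>i<m. tailsum a (Suc i) * norm (V (Suc i) \<omega>))"
      have "tailsum a (Suc n) * norm (V (Suc n) \<omega>) \<le> C" for n
      proof (cases "n < m")
        case True
        then have "tailsum a (Suc n) * norm (V (Suc n) \<omega>) \<le> (\<Sum>i<m. tailsum a (Suc i) * norm (V (Suc i) \<omega>))"
          by (intro member_le_sum[where f="\<lambda>i. tailsum a (Suc i) * norm (V (Suc i) \<omega>)"]) 
            (auto intro!: mult_nonneg_nonneg tailsum_nonneg)
        then show ?thesis using r by (simp add: C_def)
      next
        case False
        moreover have "0 \<le> (\<Sum>i<m. tailsum a (Suc i) * norm (V (Suc i) \<omega>))"
          by (intro sum_nonneg mult_nonneg_nonneg tailsum_nonneg) auto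
        ultimately show ?thesis using m[of n] by (simp add: C_def)
      qed
      then have "\<not> ennreal C < supN a V \<omega>"
        unfolding supN_gt_iff by (auto simp: not_less intro: ennreal_leI)
      then show ?case by (auto simp: not_less top_unique less_top[symmetric])
    qed }
qed

lemma nn_integral_supN_finite_if:
  assumes "prob_space M" "\<And>n. n \<ge> 1 \<Longrightarrow> V n \<in> borel_measurable M"
    and r: "0 \<le> r" "(\<integral>\<^sup>+ t\<in>{r<..}. Gam M a V t \<partial>lborel) < \<infinity>"
  shows "(\<integral>\<^sup>+ \<omega>. supN a V \<omega> \<partial>M) < \<infinity>"
proof -
  interpret prob_space M by fact
  note [measurable] = supN_measurable[OF assms(2)]
  let ?P = "\<lambda>t. emeasure M {\<omega>\<in>space M. ennreal t < supN a V \<omega>}"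
  have [measurable]: "?P \<in> borel_measurable borel"
    by measurable
  have "(\<integral>\<^sup>+ \<omega>. supN a V \<omega> \<partial>M) = (\<integral>\<^sup>+ t\<in>{0<..}. ?P t \<partial>lborel)"
    by (intro nn_integral_layer_cake sigma_finite_measure_axioms) measurable
  \<comment> \<open>Below \<open>r\<close> a probability is bounded by 1, which contributes
    \<open>r\<close>; only above \<open>r\<close> is the union bound by \<Gamma> used.\<close>
  also have "\<dots> \<le> (\<integral>\<^sup>+ t. indicator {0<..r} t + ?P t * indicator {r<..} t \<partial>lborel)"
    by (intro nn_integral_mono) (auto simp: indicator_def intro: emeasure_le_1)
  also have "\<dots> = (\<integral>\<^sup>+ t. indicator {0<..r} t \<partial>lborel) + (\<integral>\<^sup>+ t\<in>{r<..}. ?P t \<partial>lborel)"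
    by (intro nn_integral_add) auto
  also have "(\<integral>\<^sup>+ t. indicator {0<..r} t \<partial>lborel) = ennreal r" using r by simp
  also have "(\<integral>\<^sup>+ t\<in>{r<..}. ?P t \<partial>lborel) \<le> (\<integral>\<^sup>+ t\<in>{r<..}. Gam M a V t \<partial>lborel)"
    using r(1) by (intro nn_integral_mono) (auto simp: indicator_def intro!: emeasure_supN_le_Gam assms)
  finally show ?thesis using r by (simp add: le_less_trans)
qed

lemma nn_integral_supN_finite_iff:
  assumes "prob_space M" "prob_space.indep_vars M (\<lambda>_. borel) V {1..}"
  shows "(\<integral>\<^sup>+ \<omega>. supN a V \<omega> \<partial>M) < \<infinity> \<longleftrightarrow> (\<exists>r\<ge>0. (\<integral>\<^sup>+ t\<in>{r<..}. Gam M a V t \<partial>lborel) < \<infinity>)"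
proof
  interpret prob_space M by fact
  have V: "V n \<in> borel_measurable M" if "n \<ge> 1" for n
    using assms(2) that by (auto simp: indep_vars_def)
  note [measurable] = supN_measurable[OF V]
  let ?P = "\<lambda>t. emeasure M {\<omega>\<in>space M. ennreal t < supN a V \<omega>}"
  have [measurable]: "?P \<in> borel_measurable borel" by measurable
  show "(\<integral>\<^sup>+ \<omega>. supN a V \<omega> \<partial>M) < \<infinity>" if "\<exists>r\<ge>0. (\<integral>\<^sup>+ t\<in>{r<..}. Gam M a V t \<partial>lborel) < \<infinity>"
    using that nn_integral_supN_finite_if[where V=V, OF assms(1) V] by blast
  assume fin: "(\<integral>\<^sup>+ \<omega>. supN a V \<omega> \<partial>M) < \<infinity>"
  \<comment> \<open>Almost sure finiteness supplies the level from which \<Gamma> is at most twice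
    the tail; integrating that bound gives the claim.\<close>
  then have "AE \<omega> in M. supN a V \<omega> < \<infinity>"
    using nn_integral_PInf_AE[of "supN a V" M] by (auto simp: less_top)
  then obtain r where r: "r \<ge> 0" "\<And>t. t \<ge> r \<Longrightarrow> Gam M a V t \<le> 2 * ?P t"
    using Gam_le_two_tail[OF assms] by blast
  have "(\<integral>\<^sup>+ t\<in>{r<..}. Gam M a V t \<partial>lborel) \<le> (\<integral>\<^sup>+ t. 2 * (?P t * indicator {0<..} t) \<partial>lborel)"
    using r by (intro nn_integral_mono) (auto simp: indicator_def)
  also have "\<dots> = 2 * (\<integral>\<^sup>+ t\<in>{0<..}. ?P t \<partial>lborel)"
    by (rule nn_integral_cmult) measurable
  also have "\<dots> = 2 * (\<integral>\<^sup>+ \<omega>. supN a V \<omega> \<partial>M)"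
    by (subst nn_integral_layer_cake) (auto intro: sigma_finite_measure_axioms)
  also have "\<dots> < \<infinity>" using fin by (simp add: ennreal_mult_less_top)
  finally show "\<exists>r\<ge>0. (\<integral>\<^sup>+ t\<in>{r<..}. Gam M a V t \<partial>lborel) < \<infinity>" using r(1) by blast
qed

end

section \<open>Maximal inequalities for symmetric sequences\<close>

locale symmetric_seq = prob_space P + weights a for P :: "'p measure" and a +
  fixes W :: "nat \<Rightarrow> 'p \<Rightarrow> 'b::{banach, second_countable_topology}"
  assumes indep_W: "indep_vars (\<lambda>_. borel) W {1..}"
    and symmetric_W: "\<And>n. n \<ge> 1 \<Longrightarrow> distr P borel (\<lambda>x. - W n x) = distr P borel (W n)"
begin

definition L :: "'p \<Rightarrow> ennreal" where "L x = seqL a (\<lambda>i. W i x)"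
definition B :: "nat \<Rightarrow> nat \<Rightarrow> 'p \<Rightarrow> ennreal" where "B k j x = blk a k j (\<lambda>i. W i x)"
definition S :: "'p \<Rightarrow> ennreal" where "S x = (SUP j. B 0 j x)"
text \<open>The event that the first passage of the initial block norms above \<open>t\<close>
  happens at \<open>k\<close>. For fixed \<open>t\<close> these events partition the event that
  \<open>S\<close> exceeds \<open>t\<close>.\<close>

definition D :: "ennreal \<Rightarrow> nat \<Rightarrow> 'p set" where
  "D t k = {x\<in>space P. t < B 0 k x \<and> (\<forall>j<k. B 0 j x \<le> t)}"

lemma W_measurable [measurable]: "n \<ge> 1 \<Longrightarrow> W n \<in> borel_measurable P"
  using indep_W by (auto simp: indep_vars_def)

lemma L_measurable [measurable]: "L \<in> borel_measurable P"
  unfolding L_def by (rule seqL_measurable) simp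

lemma B_measurable [measurable]: "B k j \<in> borel_measurable P"
  unfolding B_def by (rule blk_measurable) simp

lemma S_measurable [measurable]: "S \<in> borel_measurable P"
  unfolding S_def by measurable

lemma D_sets [measurable]: "D t k \<in> sets P"
  unfolding D_def by measurable

lemma S_gt_iff: "t < S x \<longleftrightarrow> (\<exists>j. t < B 0 j x)"
  by (simp add: S_def less_SUP_iff)

lemma L_le_S: "L x \<le> S x"
  unfolding L_def S_def B_def by (rule seqL_le_SUP_blk)

lemma disjoint_D: "disjoint_family (D t)"
  unfolding disjoint_family_on_def
proof (intro ballI impI)
  fix j k :: nat assume "j \<noteq> k"
  then consider "j < k" | "k < j" by linarith
  then show "D t j \<inter> D t k = {}" by cases (auto simp: D_def dest: leD)
qed

lemma UN_D: "(\<Union>k. D t k) = {x\<in>space P. t < S x}"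
proof -
  have D: "\<exists>k. x \<in> D t k" if "x \<in> space P" "t < B 0 j x" for x j
  proof -
    define k where "k = (LEAST k. t < B 0 k x)"
    have "t < B 0 k x" unfolding k_def by (rule LeastI) (rule that(2))
    moreover have "B 0 i x \<le> t" if "i < k" for i
      using not_less_Least[OF that[unfolded k_def]] by (simp only: not_less)
    ultimately show ?thesis using that(1) unfolding D_def by blast
  qed
  have "D t k \<subseteq> {x\<in>space P. t < S x}" for k
    unfolding D_def S_gt_iff by blast
  then show ?thesis
  proof (intro equalityI subsetI)
    fix x assume "x \<in> {x\<in>space P. t < S x}"
    then obtain j where "x \<in> space P" "t < B 0 j x" unfolding S_gt_iff mem_Collect_eq by (elim conjE exE)
    then show "x \<in> (\<Union>k. D t k)" using D by (simp only: UN_iff bex_UNIV)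
  qed blast
qed

text \<open>Independence makes the joint law the product of the marginal laws, and symmetry makes
  each marginal insensitive to a sign. The set \<open>J\<close> may be infinite, as it is for a
  reflection of all entries after \<open>k\<close>.\<close>

lemma emeasure_sign_flip:
  assumes Q: "{w\<in>space (PiM {1..} (\<lambda>_. borel)). Q w} \<in> sets (PiM {1..} (\<lambda>_. borel))"
  shows "emeasure P {x\<in>space P. Q (\<lambda>i\<in>{1..}. if i \<in> J then - W i x else W i x)}
    = emeasure P {x\<in>space P. Q (\<lambda>i\<in>{1..}. W i x)}"
proof -
  let ?W' = "\<lambda>i x. if i \<in> J then - W i x else W i x"
  let ?PM = "PiM {1..} (\<lambda>_. borel) :: (nat \<Rightarrow> 'b) measure"
  have "indep_vars (\<lambda>_. borel) (\<lambda>i x. (if i \<in> J then uminus else id) (W i x)) {1..}"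
    by (rule indep_vars_compose2[OF indep_W]) auto
  also have "(\<lambda>i x. (if i \<in> J then uminus else id) (W i x)) = ?W'" by (auto simp: fun_eq_iff)
  finally have W': "indep_vars (\<lambda>_. borel) ?W' {1..}" .
  have W'_meas: "?W' i \<in> borel_measurable P" if "i \<ge> 1" for i
    using W' that by (auto simp: indep_vars_def)
  have "distr P ?PM (\<lambda>x. \<lambda>i\<in>{1..}. ?W' i x) = PiM {1..} (\<lambda>i. distr P borel (?W' i))"
    using indep_vars_iff_distr_eq_PiM'[of "{1..}" ?W' "\<lambda>_. borel"] W' W'_meas by auto
  also have "\<dots> = PiM {1..} (\<lambda>i. distr P borel (W i))"
  proof (intro PiM_cong refl)
    fix i :: nat assume "i \<in> {1..}"
    then show "distr P borel (?W' i) = distr P borel (W i)"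
      using symmetric_W[of i] by (cases "i \<in> J") auto
  qed
  also have "\<dots> = distr P ?PM (\<lambda>x. \<lambda>i\<in>{1..}. W i x)"
    using indep_vars_iff_distr_eq_PiM'[of "{1..}" W "\<lambda>_. borel"] indep_W by auto
  finally have eq: "distr P ?PM (\<lambda>x. \<lambda>i\<in>{1..}. ?W' i x) = distr P ?PM (\<lambda>x. \<lambda>i\<in>{1..}. W i x)" .
  have m: "(\<lambda>x. \<lambda>i\<in>{1..}. ?W' i x) \<in> measurable P ?PM" "(\<lambda>x. \<lambda>i\<in>{1..}. W i x) \<in> measurable P ?PM"
    by (intro measurable_restrict, use W'_meas in simp)+
  have e: "emeasure (distr P ?PM f) {w\<in>space ?PM. Q w} = emeasure P {x\<in>space P. Q (f x)}"
    if "f \<in> measurable P ?PM" for f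
    using that by (subst emeasure_distr[OF that Q]) (auto intro!: arg_cong[where f="emeasure P"] dest: measurable_space)
  show ?thesis using eq e[OF m(1)] e[OF m(2)] by simp
qed

text \<open>Levy's inequality: reflecting the summands after the first passage time \<open>k\<close> preserves
  the joint law and the event \<open>D t k\<close>, while the two values of \<open>L\<close> cannot both be at most \<open>t\<close>.\<close>

lemma emeasure_S_le: "emeasure P {x\<in>space P. t < S x} \<le> 2 * emeasure P {x\<in>space P. t < L x}"
proof -
  have "emeasure P (D t k) \<le> 2 * emeasure P (D t k \<inter> {x\<in>space P. t < L x})" for k
  proof -
    define L' where "L' x = seqL a (\<lambda>i. if k < i then - W i x else W i x)" for x
    have [measurable]: "L' \<in> borel_measurable P"
      unfolding L'_def
    proof (rule seqL_measurable)
      fix i :: nat assume "1 \<le> i"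
      then have [measurable]: "W i \<in> borel_measurable P" by simp
      show "(\<lambda>x. if k < i then - W i x else W i x) \<in> borel_measurable P" by measurable
    qed
    define Q where "Q w \<longleftrightarrow> t < seqL a w \<and> t < blk a 0 k w \<and> (\<forall>j<k. blk a 0 j w \<le> t)" for w :: "nat \<Rightarrow> 'b"
    have c: "(\<lambda>w. w i) \<in> borel_measurable (PiM {1..} (\<lambda>_. borel))" if "1 \<le> i" for i :: nat
      using that by (intro measurable_component_singleton) auto
    have [measurable]: "(\<lambda>w. seqL a w) \<in> borel_measurable (PiM {1..} (\<lambda>_. borel :: 'b measure))"
      by (rule seqL_measurable[where X="\<lambda>i w. w i"]) (rule c)
    have [measurable]: "(\<lambda>w. blk a 0 j w) \<in> borel_measurable (PiM {1..} (\<lambda>_. borel :: 'b measure))" for j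
      by (rule blk_measurable[where X="\<lambda>i w. w i"]) (rule c, simp)
    have Q: "{w\<in>space (PiM {1..} (\<lambda>_. borel)). Q w} \<in> sets (PiM {1..} (\<lambda>_. borel))"
      unfolding Q_def by measurable
    \<comment> \<open>The restricted sequence is \<open>undefined\<close> at index 0, but
      \<open>seqL\<close> and \<open>blk a 0\<close> never read that entry.\<close>
    have 1: "{x\<in>space P. Q (\<lambda>i\<in>{1..}. W i x)} = D t k \<inter> {x\<in>space P. t < L x}"
    proof -
      have "seqL a (\<lambda>i\<in>{1..}. W i x) = L x" "blk a 0 j (\<lambda>i\<in>{1..}. W i x) = B 0 j x" for x j
        by (auto simp: L_def B_def intro!: seqL_cong blk_cong)
      then show ?thesis by (auto simp: Q_def D_def)
    qed
    have 2: "{x\<in>space P. Q (\<lambda>i\<in>{1..}. if i \<in> {k<..} then - W i x else W i x)} = D t k \<inter> {x\<in>space P. t < L' x}"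
    proof -
      have "seqL a (\<lambda>i\<in>{1..}. if i \<in> {k<..} then - W i x else W i x) = L' x" for x
        by (auto simp: L'_def intro!: seqL_cong)
      moreover have "blk a 0 j (\<lambda>i\<in>{1..}. if i \<in> {k<..} then - W i x else W i x) = B 0 j x" if "j \<le> k" for x j
        using that by (auto simp: B_def intro!: blk_cong)
      ultimately show ?thesis by (auto simp: Q_def D_def)
    qed
    have "D t k \<subseteq> (D t k \<inter> {x\<in>space P. t < L x}) \<union> (D t k \<inter> {x\<in>space P. t < L' x})"
    proof
      fix x assume x: "x \<in> D t k"
      then have "2 * t < 2 * B 0 k x"
        by (auto simp: D_def ennreal_mult_strict_left_mono)
      also have "\<dots> \<le> L x + L' x"
        using blk_reflect[of k "\<lambda>i. W i x"] by (simp add: B_def L_def L'_def)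
      finally have "t < L x \<or> t < L' x"
        by (metis add_mono mult_2 not_less)
      then show "x \<in> (D t k \<inter> {x\<in>space P. t < L x}) \<union> (D t k \<inter> {x\<in>space P. t < L' x})"
        using x by (auto simp: D_def)
    qed
    then have "emeasure P (D t k) \<le> emeasure P ((D t k \<inter> {x\<in>space P. t < L x}) \<union> (D t k \<inter> {x\<in>space P. t < L' x}))"
      by (rule emeasure_mono) measurable
    also have "\<dots> \<le> emeasure P (D t k \<inter> {x\<in>space P. t < L x}) + emeasure P (D t k \<inter> {x\<in>space P. t < L' x})"
      by (rule emeasure_subadditive) measurable
    also have "emeasure P (D t k \<inter> {x\<in>space P. t < L' x}) = emeasure P (D t k \<inter> {x\<in>space P. t < L x})"
      using emeasure_sign_flip[OF Q, of "{k<..}"] by (simp only: 1 2)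
    finally show ?thesis by (simp add: mult_2)
  qed
  then have "(\<Sum>k. emeasure P (D t k)) \<le> (\<Sum>k. 2 * emeasure P (D t k \<inter> {x\<in>space P. t < L x}))"
    by (intro suminf_le) auto
  also have "\<dots> = 2 * emeasure P (\<Union>k. D t k \<inter> {x\<in>space P. t < L x})"
    using disjoint_D by (subst ennreal_suminf_cmult, subst suminf_emeasure) 
      (auto simp: disjoint_family_on_def)
  also have "\<dots> \<le> 2 * emeasure P {x\<in>space P. t < L x}"
    by (intro mult_left_mono emeasure_mono) auto
  also have "(\<Sum>k. emeasure P (D t k)) = emeasure P {x\<in>space P. t < S x}"
    using disjoint_D by (subst suminf_emeasure) (auto simp: UN_D)
  finally show ?thesis .
qed

text \<open>The event that \<open>S\<close> is infinite lies in every event that \<open>S\<close>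
  exceeds \<open>r\<close>, and Levy's inequality bounds the latter by twice a tail of
  \<open>L\<close> that is as small as desired.\<close>

lemma AE_S_finite:
  assumes "AE x in P. L x < \<infinity>"
  shows "AE x in P. S x < \<infinity>"
proof -
  have "emeasure P {x\<in>space P. \<top> \<le> S x} \<le> 2 * ennreal e" if e: "e > 0" for e
  proof -
    obtain r where r: "emeasure P {x\<in>space P. ennreal r < L x} \<le> ennreal e"
      using AE_finite_imp_tail_le[OF L_measurable assms e] by blast
    have "emeasure P {x\<in>space P. \<top> \<le> S x} \<le> emeasure P {x\<in>space P. ennreal r < S x}"
      by (intro emeasure_mono) (auto simp: top_unique)
    also have "\<dots> \<le> 2 * emeasure P {x\<in>space P. ennreal r < L x}" by (rule emeasure_S_le)
    also have "\<dots> \<le> 2 * ennreal e" using r by (rule mult_left_mono) simp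
    finally show ?thesis .
  qed
  from this[of "e/2" for e] have "emeasure P {x\<in>space P. \<top> \<le> S x} \<le> 0 + ennreal e" if "e > 0" for e
    using that ennreal_mult[of 2 "e/2"] by simp
  then have "emeasure P {x\<in>space P. \<top> \<le> S x} \<le> 0"
    by (rule ennreal_le_epsilon) 
  then show ?thesis by (intro AE_I[where N="{x\<in>space P. \<top> \<le> S x}"]) (auto simp: not_less top_unique less_top[symmetric])
qed

lemma nn_integral_S_le: "(\<integral>\<^sup>+ x. S x \<partial>P) \<le> 2 * (\<integral>\<^sup>+ x. L x \<partial>P)"
proof -
  have "(\<integral>\<^sup>+ x. S x \<partial>P) = (\<integral>\<^sup>+t\<in>{0<..}. emeasure P {x\<in>space P. ennreal t < S x} \<partial>lborel)"
    by (intro nn_integral_layer_cake sigma_finite_measure_axioms S_measurable)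
  also have "\<dots> \<le> (\<integral>\<^sup>+t. 2 * (emeasure P {x\<in>space P. ennreal t < L x} * indicator {0<..} t) \<partial>lborel)"
    using emeasure_S_le by (intro nn_integral_mono) (auto simp: indicator_def)
  also have "\<dots> = 2 * (\<integral>\<^sup>+t\<in>{0<..}. emeasure P {x\<in>space P. ennreal t < L x} \<partial>lborel)"
    by (rule nn_integral_cmult) measurable
  also have "(\<integral>\<^sup>+t\<in>{0<..}. emeasure P {x\<in>space P. ennreal t < L x} \<partial>lborel) = (\<integral>\<^sup>+ x. L x \<partial>P)"
    by (intro nn_integral_layer_cake[symmetric] sigma_finite_measure_axioms L_measurable)
  finally show ?thesis .
qed

lemma supN_le_S: "supN a W x \<le> 2 * S x"
  unfolding S_def B_def by (rule supN_le_blk)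

text \<open>The first passage event reads only the variables up to \<open>k\<close>, the blocks
  \<open>(k, j]\<close> only those after \<open>k\<close>; families over disjoint index sets are
  independent.\<close>

lemma emeasure_D_Int_tail:
  "emeasure P (D t k \<inter> {x\<in>space P. \<exists>j\<ge>k. u < B k j x})
    = emeasure P (D t k) * emeasure P {x\<in>space P. \<exists>j\<ge>k. u < B k j x}"
proof -
  let ?M1 = "PiM {0<..k} (\<lambda>_. borel) :: (nat \<Rightarrow> 'b) measure"
  let ?M2 = "PiM {k<..} (\<lambda>_. borel) :: (nat \<Rightarrow> 'b) measure"
  have ind: "indep_var ?M1 (\<lambda>x. \<lambda>i\<in>{0<..k}. W i x) ?M2 (\<lambda>x. \<lambda>i\<in>{k<..}. W i x)"
    by (rule indep_var_restrict[OF indep_W]) auto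
  have b1: "(\<lambda>w. blk a 0 j w) \<in> borel_measurable ?M1" if "j \<le> k" for j
    using that by (intro blk_measurable[where X="\<lambda>i w. w i"] measurable_component_singleton) auto
  have b2: "(\<lambda>w. blk a k j w) \<in> borel_measurable ?M2" for j
    by (intro blk_measurable[where X="\<lambda>i w. w i"] measurable_component_singleton) auto
  let ?E = "{w\<in>space ?M1. t < blk a 0 k w \<and> (\<forall>j\<in>{..<k}. blk a 0 j w \<le> t)}"
  let ?F = "{w\<in>space ?M2. \<exists>j\<in>{k..}. u < blk a k j w}"
  have le: "{w\<in>space ?M1. blk a 0 j w \<le> t} \<in> sets ?M1" if "j < k" for j
    using borel_measurable_le[OF b1[of j] borel_measurable_const[of t]] that by simp
  have "{w\<in>space ?M1. \<forall>j\<in>{..<k}. blk a 0 j w \<le> t} \<in> sets ?M1"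
    by (rule sets.sets_Collect_finite_All) (simp_all only: le lessThan_iff finite_lessThan)
  with borel_measurable_less[OF borel_measurable_const[of t] b1[of k]]
  have E: "?E \<in> sets ?M1"
    by (intro sets.sets_Collect_conj) simp_all
  have F: "?F \<in> sets ?M2"
    by (rule sets.sets_Collect_countable_Bex[OF borel_measurable_less[OF borel_measurable_const b2]])
  have 1: "(\<lambda>x. \<lambda>i\<in>{0<..k}. W i x) -` ?E \<inter> space P = D t k"
  proof -
    have "blk a 0 j (\<lambda>i\<in>{0<..k}. W i x) = B 0 j x" if "j \<le> k" for x j
      unfolding B_def using that by (intro blk_cong) auto
    then show ?thesis by (auto simp: D_def space_PiM)
  qed
  have 2: "(\<lambda>x. \<lambda>i\<in>{k<..}. W i x) -` ?F \<inter> space P = {x\<in>space P. \<exists>j\<ge>k. u < B k j x}"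
  proof -
    have "blk a k j (\<lambda>i\<in>{k<..}. W i x) = B k j x" for x j
      unfolding B_def by (intro blk_cong) auto
    then show ?thesis by (auto simp: space_PiM)
  qed
  have "prob (D t k \<inter> {x\<in>space P. \<exists>j\<ge>k. u < B k j x}) = prob (D t k) * prob {x\<in>space P. \<exists>j\<ge>k. u < B k j x}"
  proof -
    have "(\<lambda>x. (\<lambda>i\<in>{0<..k}. W i x, \<lambda>i\<in>{k<..}. W i x)) -` (?E \<times> ?F) \<inter> space P
      = D t k \<inter> {x\<in>space P. \<exists>j\<ge>k. u < B k j x}"
      unfolding 1[symmetric] 2[symmetric] by blast
    then show ?thesis using indep_varD[OF ind E F] by (simp only: 1 2)
  qed
  then show ?thesis by (simp add: emeasure_eq_measure ennreal_mult)
qed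

text \<open>Hoffmann-Jorgensen's inequality: at the first passage time \<open>k\<close> over \<open>t\<close> the previous partial
  sum is at most \<open>t\<close> and the jump at most \<open>s\<close>, so the remainder after \<open>k\<close>, which is independent
  of the past, must exceed \<open>2t\<close>.\<close>

lemma emeasure_S_gt_le:
  assumes st: "0 \<le> s" "0 \<le> t"
  shows "emeasure P {x\<in>space P. ennreal (s + 3 * t) < S x}
    \<le> emeasure P {x\<in>space P. ennreal s < supN a W x} + (emeasure P {x\<in>space P. ennreal t < S x})\<^sup>2"
proof -
  let ?t = "ennreal t" and ?N = "{x\<in>space P. ennreal s < supN a W x}" and ?G = "{x\<in>space P. ennreal t < S x}"
  let ?T = "\<lambda>k. {x\<in>space P. \<exists>j\<ge>k. ennreal (2 * t) < B k j x}"
  have [measurable]: "supN a W \<in> borel_measurable P" by (rule supN_measurable) simp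
  have T [measurable]: "?T k \<in> sets P" for k
    by measurable
  have sub: "{x\<in>space P. ennreal (s + 3 * t) < S x} \<subseteq> ?N \<union> (\<Union>k. D ?t k \<inter> ?T k)"
  proof
    fix x assume "x \<in> {x\<in>space P. ennreal (s + 3 * t) < S x}"
    then have x: "x \<in> space P" "ennreal (s + 3 * t) < S x" by auto
    show "x \<in> ?N \<union> (\<Union>k. D ?t k \<inter> ?T k)"
    proof (cases "x \<in> ?N")
      case False
      then have N: "supN a W x \<le> ennreal s" using x by auto
      obtain j where j: "ennreal (s + 3 * t) < B 0 j x" using x by (auto simp: S_gt_iff)
      have "ennreal t \<le> ennreal (s + 3 * t)" using st by (intro ennreal_leI) auto
      then have "ennreal t < S x" using x(2) by (rule le_less_trans)
      then have "x \<in> (\<Union>k. D ?t k)" using x by (simp add: UN_D)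
      then obtain k where k: "x \<in> D ?t k" by blast
      then have kt: "?t < B 0 k x" "\<And>j. j < k \<Longrightarrow> B 0 j x \<le> ?t" by (auto simp: D_def)
      \<comment> \<open>The empty block has norm 0 and cannot exceed the level, so a passage has a
        predecessor.\<close>
      obtain l where l: "k = Suc l"
        using kt(1) by (cases k) (auto simp: B_def blk_eq_0)
      have "k \<le> j"
      proof (rule ccontr)
        assume "\<not> k \<le> j"
        then have "B 0 j x \<le> ?t" using kt(2) by simp
        then show False using j \<open>ennreal t \<le> ennreal (s + 3 * t)\<close> by (meson leD le_less_trans order_trans)
      qed
      have s: "B l k x \<le> ennreal s"
      proof -
        have "ennreal (tailsum a (Suc l) * norm (W (Suc l) x)) \<le> supN a W x"
          unfolding supN_def by (rule SUP_upper2[of "Suc l"]) auto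
        then show ?thesis using N by (simp add: B_def l blk_single)
      qed
      \<comment> \<open>Of the \<open>3 * t\<close> in the level, \<open>t\<close> is spent on the
        block before the jump, which leaves \<open>2 * t\<close> for the block after it.\<close>
      have "B 0 j x \<le> B 0 l x + (B l k x + B k j x)"
        unfolding B_def using \<open>k \<le> j\<close> l
        by (intro order_trans[OF blk_triangle[of 0 l j]] add_left_mono blk_triangle) auto
      also have "\<dots> \<le> ?t + (ennreal s + B k j x)"
        using kt(2)[of l] s l by (intro add_mono) auto
      finally have *: "ennreal (s + 3 * t) < ennreal (t + s) + B k j x"
        using j st by (simp add: ennreal_plus add.assoc less_le_trans)
      have "ennreal (2 * t) < B k j x"
      proof (rule ccontr)
        assume "\<not> ennreal (2 * t) < B k j x"
        then have "ennreal (t + s) + B k j x \<le> ennreal (t + s) + ennreal (2 * t)"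
          by (intro add_left_mono) auto
        also have "\<dots> = ennreal (s + 3 * t)" using st by (subst ennreal_plus[symmetric]) auto
        finally show False using * by simp
      qed
      then show ?thesis using k x \<open>k \<le> j\<close> by auto
    qed simp
  qed
  \<comment> \<open>A block after \<open>k\<close> is a difference of two initial blocks, so
    exceeding \<open>2 * t\<close> forces one of them above \<open>t\<close>. This is the origin of
    the second factor in the square.\<close>
  have tail: "emeasure P (?T k) \<le> emeasure P ?G" for k
  proof (rule emeasure_mono)
    show "?T k \<subseteq> ?G"
    proof
      fix x assume "x \<in> ?T k"
      then obtain j where x: "x \<in> space P" "k \<le> j" "ennreal (2 * t) < B k j x" by auto
      have "B k j x \<le> B 0 j x + B 0 k x" unfolding B_def using x by (intro blk_diff_le)
      also have "\<dots> \<le> 2 * S x" unfolding S_def mult_2 by (intro add_mono SUP_upper) auto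
      finally have "ennreal (2 * t) < 2 * S x" using x(3) by simp
      moreover have "2 * S x \<le> ennreal (2 * t)" if "S x \<le> ?t"
        using mult_left_mono[OF that, of 2] by (simp add: ennreal_mult')
      ultimately have "\<not> S x \<le> ?t" by (meson leD)
      then show "x \<in> ?G" using x by (simp add: not_le)
    qed
  qed measurable
  have "emeasure P {x\<in>space P. ennreal (s + 3 * t) < S x} \<le> emeasure P (?N \<union> (\<Union>k. D ?t k \<inter> ?T k))"
    by (intro emeasure_mono sub) measurable
  also have "\<dots> \<le> emeasure P ?N + emeasure P (\<Union>k. D ?t k \<inter> ?T k)"
    by (rule emeasure_subadditive) measurable
  also have "emeasure P (\<Union>k. D ?t k \<inter> ?T k) \<le> (\<Sum>k. emeasure P (D ?t k \<inter> ?T k))"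
    by (rule emeasure_subadditive_countably) auto
  also have "\<dots> \<le> (\<Sum>k. emeasure P (D ?t k) * emeasure P ?G)"
    unfolding emeasure_D_Int_tail by (intro suminf_le mult_left_mono tail) auto
  also have "\<dots> = (\<Sum>k. emeasure P (D ?t k)) * emeasure P ?G" by simp
  also have "(\<Sum>k. emeasure P (D ?t k)) = emeasure P ?G"
    using disjoint_D by (subst suminf_emeasure) (auto simp: UN_D)
  finally show ?thesis by (simp add: power2_eq_square add_left_mono)
qed

end

section \<open>Integrability of the supremum of the initial block norms\<close>

lemma SUP_min_of_nat: "(SUP n::nat. min c (ennreal (real n))) = c"
proof (rule antisym)
  show "c \<le> (SUP n::nat. min c (ennreal (real n)))"
  proof (cases c)
    case (real r)
    obtain n :: nat where "r \<le> real n" using real_arch_simple by blast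
    then show ?thesis using real by (intro SUP_upper2[of n]) (auto simp: min_def intro: ennreal_leI)
  next
    case top
    have *: "(SUP n::nat. ennreal (real n)) = \<top>"
      using ennreal_SUP_of_nat_eq_top by (simp only: ennreal_of_nat_eq_real_of_nat)
    have "min c x = x" for x using top by simp
    then show ?thesis by (simp only: * top_greatest)
  qed
qed (auto intro: SUP_least)

context symmetric_seq begin

text \<open>Taking \<open>s = t\<close> in Hoffmann-Jorgensen's inequality and integrating over
  \<open>t\<close> yields E S / 4 \<le> m + u + E S / 8 with \<open>m\<close> the mean of
  \<open>N\<close>. For a truncation of \<open>S\<close> this can be solved, and the resulting bound
  \<open>8 * (m + u)\<close> does not depend on the truncation height.\<close>

lemma nn_integral_S_finite:
  assumes fin: "AE x in P. L x < \<infinity>" and N: "(\<integral>\<^sup>+ x. supN a W x \<partial>P) < \<infinity>"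
  shows "(\<integral>\<^sup>+ x. S x \<partial>P) < \<infinity>"
proof -
  have N_meas [measurable]: "supN a W \<in> borel_measurable P" by (rule supN_measurable) simp
  \<comment> \<open>Any value below 1/4 would serve: the tail at level \<open>t + 3 * t\<close>
    integrates to a quarter of the mean, and the quadratic term has to cost less than that.\<close>
  obtain u where u: "0 \<le> u" "\<And>t. u \<le> t \<Longrightarrow> emeasure P {x\<in>space P. ennreal t < S x} \<le> ennreal (1/8)"
    using AE_finite_imp_tail_le[OF S_measurable AE_S_finite[OF fin], of "1/8"] by auto
  obtain m where m: "(\<integral>\<^sup>+ x. supN a W x \<partial>P) = ennreal m" "0 \<le> m"
    using N by (cases "\<integral>\<^sup>+ x. supN a W x \<partial>P") auto
  have bound: "(\<integral>\<^sup>+ x. min (S x) (ennreal (real n)) \<partial>P) \<le> ennreal (8 * (m + u))" for n :: nat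
  proof -
    define T where "T x = min (S x) (ennreal (real n))" for x
    have [measurable]: "T \<in> borel_measurable P" unfolding T_def by measurable
    let ?P = "\<lambda>f t. emeasure P {x\<in>space P. ennreal t < f x}"
    have T_meas [measurable]: "?P T \<in> borel_measurable borel" "?P (supN a W) \<in> borel_measurable borel"
      by measurable
    \<comment> \<open>Three ranges of \<open>t\<close>. Up to \<open>u\<close> a probability is at
      most 1. Above \<open>u\<close> with \<open>t + 3 * t < real n\<close> the truncation is
      invisible at the levels involved. Otherwise the truncated variable cannot exceed
      \<open>t + 3 * t\<close> and the left side is 0.\<close>
    have pw: "?P (\<lambda>x. ennreal (1/4) * T x) t \<le> ?P (supN a W) t + indicator {0<..u} t + ennreal (1/8) * ?P T t"
      if "0 < t" for t
    proof (cases "t \<le> u")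
      case True
      then have "?P (\<lambda>x. ennreal (1/4) * T x) t \<le> indicator {0<..u} t"
        using that by (simp add: emeasure_le_1)
      then show ?thesis by (rule order_trans) (simp add: add_increasing add_increasing2)
    next
      case False
      have sub: "ennreal (t + 3 * t) < T x" if "ennreal t < ennreal (1/4) * T x" for x
      proof -
        have "4 * ennreal t < 4 * (ennreal (1/4) * T x)"
          using that by (intro ennreal_mult_strict_left_mono) auto
        also have "4 * (ennreal (1/4) * T x) = ennreal 4 * ennreal (1/4) * T x" by (simp add: mult.assoc)
        also have "\<dots> = T x" by (subst ennreal_mult[symmetric]) auto
        also have "4 * ennreal t = ennreal (t + 3 * t)"
          using \<open>0 < t\<close> by (subst ennreal_numeral[symmetric], subst ennreal_mult[symmetric]) auto
        finally show ?thesis .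
      qed
      show ?thesis
      proof (cases "t + 3 * t < real n")
        case True
        have "?P (\<lambda>x. ennreal (1/4) * T x) t \<le> ?P S (t + 3 * t)"
          using sub by (intro emeasure_mono) (auto simp: T_def)
        also have "\<dots> \<le> ?P (supN a W) t + (?P S t)\<^sup>2"
          using \<open>0 < t\<close> by (intro emeasure_S_gt_le) auto
        also have "(?P S t)\<^sup>2 \<le> ennreal (1/8) * ?P S t"
          unfolding power2_eq_square using u(2)[of t] False by (intro mult_right_mono) auto
        also have "?P S t = ?P T t"
        proof -
          have "ennreal t < ennreal (real n)" using True \<open>0 < t\<close> by (intro ennreal_lessI) auto
          then show ?thesis by (simp add: T_def)
        qed
        finally show ?thesis using False by (simp add: add_left_mono)
      next
        case nlt: False
        have "\<not> ennreal t < ennreal (1/4) * T x" for x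
        proof
          assume "ennreal t < ennreal (1/4) * T x"
          from sub[OF this] have "ennreal (t + 3 * t) < ennreal (real n)" by (simp add: T_def)
          then show False using nlt \<open>0 < t\<close> by (simp add: ennreal_less_iff)
        qed
        then have "?P (\<lambda>x. ennreal (1/4) * T x) t = 0" by simp
        then show ?thesis by simp
      qed
    qed
    \<comment> \<open>Truncation makes this mean finite, which permits cancelling the eighth of
      \<open>s\<close> on the right against the quarter on the left.\<close>
    obtain s where s: "(\<integral>\<^sup>+ x. T x \<partial>P) = ennreal s" "0 \<le> s"
    proof -
      have "(\<integral>\<^sup>+ x. T x \<partial>P) \<le> (\<integral>\<^sup>+ x. ennreal (real n) \<partial>P)" by (intro nn_integral_mono) (simp add: T_def)
      also have "\<dots> < \<infinity>" by (simp add: emeasure_space_1)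
      finally show ?thesis using that by (cases "\<integral>\<^sup>+ x. T x \<partial>P") auto
    qed
    have "ennreal (1/4 * s) = (\<integral>\<^sup>+ x. ennreal (1/4) * T x \<partial>P)"
      using s by (subst nn_integral_cmult) (simp_all add: ennreal_mult[symmetric])
    also have "\<dots> = (\<integral>\<^sup>+t\<in>{0<..}. ?P (\<lambda>x. ennreal (1/4) * T x) t \<partial>lborel)"
      by (rule nn_integral_layer_cake) (auto intro: sigma_finite_measure_axioms)
    also have "\<dots> \<le> (\<integral>\<^sup>+t. (?P (supN a W) t * indicator {0<..} t + indicator {0<..u} t) + ennreal (1/8) * (?P T t * indicator {0<..} t) \<partial>lborel)"
      using pw by (intro nn_integral_mono) (auto simp: indicator_def)
    also have "\<dots> = (\<integral>\<^sup>+t. ?P (supN a W) t * indicator {0<..} t + indicator {0<..u} t \<partial>lborel)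
        + (\<integral>\<^sup>+t. ennreal (1/8) * (?P T t * indicator {0<..} t) \<partial>lborel)"
      by (intro nn_integral_add) auto
    also have "(\<integral>\<^sup>+t. ?P (supN a W) t * indicator {0<..} t + indicator {0<..u} t \<partial>lborel)
      = (\<integral>\<^sup>+t\<in>{0<..}. ?P (supN a W) t \<partial>lborel) + (\<integral>\<^sup>+t. indicator {0<..u} t \<partial>lborel)"
      by (intro nn_integral_add) auto
    also have "(\<integral>\<^sup>+t\<in>{0<..}. ?P (supN a W) t \<partial>lborel) = ennreal m"
      unfolding m(1)[symmetric] by (intro nn_integral_layer_cake[symmetric] sigma_finite_measure_axioms N_meas)
    also have "(\<integral>\<^sup>+t. indicator {0<..u} t \<partial>lborel) = ennreal u" using u(1) by simp
    also have "(\<integral>\<^sup>+t. ennreal (1/8) * (?P T t * indicator {0<..} t) \<partial>lborel)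
      = ennreal (1/8) * (\<integral>\<^sup>+t\<in>{0<..}. ?P T t \<partial>lborel)"
      by (rule nn_integral_cmult) auto
    also have "(\<integral>\<^sup>+t\<in>{0<..}. ?P T t \<partial>lborel) = ennreal s"
      unfolding s(1)[symmetric] by (intro nn_integral_layer_cake[symmetric] sigma_finite_measure_axioms) measurable
    also have "ennreal m + ennreal u + ennreal (1/8) * ennreal s = ennreal (m + u + 1/8 * s)"
      using m(2) u(1) s(2) by (simp add: ennreal_mult[symmetric] flip: ennreal_plus)
    finally have "1/4 * s \<le> m + u + 1/8 * s"
      using m(2) u(1) s(2) by (subst (asm) ennreal_le_iff) auto
    then have "s \<le> 8 * (m + u)" by simp
    then show ?thesis using s unfolding T_def by (simp add: ennreal_leI)
  qed
  have "(\<integral>\<^sup>+ x. S x \<partial>P) = (\<integral>\<^sup>+ x. (SUP n::nat. min (S x) (ennreal (real n))) \<partial>P)"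
    by (simp add: SUP_min_of_nat)
  also have "\<dots> = (SUP n::nat. \<integral>\<^sup>+ x. min (S x) (ennreal (real n)) \<partial>P)"
    by (rule nn_integral_monotone_convergence_SUP) (auto simp: incseq_def le_fun_def min_le_iff_disj intro!: ennreal_leI)
  also have "\<dots> \<le> ennreal (8 * (m + u))" by (intro SUP_least bound)
  finally show ?thesis by (rule le_less_trans) simp
qed

end

section \<open>Symmetrization\<close>

text \<open>On preimages of rectangles the product measure splits into two factors, each of which
  splits over the indices by independence. Such preimages are stable under intersection, so
  independence extends to the generated \<sigma>-algebras.\<close>

lemma (in prob_space) indep_vars_pair_copy:
  assumes X: "indep_vars N X I"
  shows "prob_space.indep_vars (M \<Otimes>\<^sub>M M) (\<lambda>i. N i \<Otimes>\<^sub>M N i) (\<lambda>i (x, y). (X i x, X i y)) I"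
proof -
  interpret PP: pair_prob_space M M ..
  have Xm [measurable]: "X i \<in> measurable M (N i)" if "i \<in> I" for i
    using X that by (auto simp: indep_vars_def)
  have Zm: "(\<lambda>(x, y). (X i x, X i y)) \<in> measurable (M \<Otimes>\<^sub>M M) (N i \<Otimes>\<^sub>M N i)" if "i \<in> I" for i
    using Xm[OF that] by measurable
  define F where "F i = {(\<lambda>(x, y). (X i x, X i y)) -` C \<inter> space (M \<Otimes>\<^sub>M M) | C. C \<in> {A \<times> B | A B. A \<in> sets (N i) \<and> B \<in> sets (N i)}}" for i
  have F_eq: "(\<lambda>(x, y). (X i x, X i y)) -` (A \<times> B) \<inter> space (M \<Otimes>\<^sub>M M) = (X i -` A \<inter> space M) \<times> (X i -` B \<inter> space M)" for i A B
    by (auto simp: space_pair_measure)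
  have FD: "\<exists>A B. A \<in> sets (N i) \<and> B \<in> sets (N i) \<and> E = (X i -` A \<inter> space M) \<times> (X i -` B \<inter> space M)" if "E \<in> F i" for i E
    using that unfolding F_def F_eq[symmetric] by blast
  have "PP.indep_sets F I"
  proof (rule PP.indep_setsI)
    fix i assume i: "i \<in> I"
    show "F i \<subseteq> sets (M \<Otimes>\<^sub>M M)"
      using Xm[OF i] by (auto dest!: FD)
  next
    fix E J assume J: "J \<noteq> {}" "J \<subseteq> I" "finite J" and "\<forall>j\<in>J. E j \<in> F j"
    then have "\<forall>j\<in>J. \<exists>A B. A \<in> sets (N j) \<and> B \<in> sets (N j) \<and> E j = (X j -` A \<inter> space M) \<times> (X j -` B \<inter> space M)"
      using FD by blast
    then obtain A B where AB: "\<And>j. j \<in> J \<Longrightarrow> A j \<in> sets (N j)" "\<And>j. j \<in> J \<Longrightarrow> B j \<in> sets (N j)"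
       "\<And>j. j \<in> J \<Longrightarrow> E j = (X j -` A j \<inter> space M) \<times> (X j -` B j \<inter> space M)"
      by metis
    have meas: "X j -` A j \<inter> space M \<in> events" "X j -` B j \<inter> space M \<in> events" if "j \<in> J" for j
      using AB(1,2)[OF that] that J(2) by (auto intro: measurable_sets[OF Xm])
    have times: "PP.prob (A' \<times> B') = prob A' * prob B'" if "A' \<in> events" "B' \<in> events" for A' B'
      using emeasure_pair_measure_Times[OF that]
      by (simp add: PP.emeasure_eq_measure emeasure_eq_measure ennreal_mult[symmetric])
    \<comment> \<open>An intersection of rectangles is again a rectangle; for empty \<open>J\<close>
      both sides would degenerate to the whole type.\<close>
    have "(\<Inter>j\<in>J. E j) = (\<Inter>j\<in>J. X j -` A j \<inter> space M) \<times> (\<Inter>j\<in>J. X j -` B j \<inter> space M)"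
      using J(1) by (auto simp: AB(3))
    then have "PP.prob (\<Inter>j\<in>J. E j) = prob (\<Inter>j\<in>J. X j -` A j \<inter> space M) * prob (\<Inter>j\<in>J. X j -` B j \<inter> space M)"
      using J meas by (simp only:) (intro times sets.finite_INT, auto)
    also have "\<dots> = (\<Prod>j\<in>J. prob (X j -` A j \<inter> space M)) * (\<Prod>j\<in>J. prob (X j -` B j \<inter> space M))"
      using J AB by (intro arg_cong2[where f="(*)"] indep_varsD[OF X]) auto
    also have "\<dots> = (\<Prod>j\<in>J. PP.prob (E j))"
      unfolding prod.distrib[symmetric] by (intro prod.cong refl) (simp add: AB(3) times meas)
    finally show "PP.prob (\<Inter>j\<in>J. E j) = (\<Prod>j\<in>J. PP.prob (E j))" .
  qed
  then have "PP.indep_sets (\<lambda>i. sigma_sets (space (M \<Otimes>\<^sub>M M)) (F i)) I"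
  proof (rule PP.indep_sets_sigma)
    fix i assume "i \<in> I"
    show "Int_stable (F i)"
    proof (rule Int_stableI)
      fix E E' assume "E \<in> F i" "E' \<in> F i"
      then obtain C C' where C: "E = (\<lambda>(x, y). (X i x, X i y)) -` C \<inter> space (M \<Otimes>\<^sub>M M)" "E' = (\<lambda>(x, y). (X i x, X i y)) -` C' \<inter> space (M \<Otimes>\<^sub>M M)"
         "C \<in> {A \<times> B | A B. A \<in> sets (N i) \<and> B \<in> sets (N i)}" "C' \<in> {A \<times> B | A B. A \<in> sets (N i) \<and> B \<in> sets (N i)}"
        unfolding F_def by blast
      from this(3,4) have "C \<inter> C' \<in> {A \<times> B | A B. A \<in> sets (N i) \<and> B \<in> sets (N i)}"
        by (auto simp: Times_Int_Times) (metis sets.Int)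
      moreover have "E \<inter> E' = (\<lambda>(x, y). (X i x, X i y)) -` (C \<inter> C') \<inter> space (M \<Otimes>\<^sub>M M)"
        unfolding C(1,2) by (simp only: vimage_Int Int_ac Int_left_absorb)
      ultimately show "E \<inter> E' \<in> F i" unfolding F_def mem_Collect_eq by (intro exI[of _ "C \<inter> C'"] conjI)
    qed
  qed
  \<comment> \<open>Preimages commute with generating a \<sigma>-algebra, so the preimages of
    rectangles generate all preimages of measurable sets.\<close>
  also have "PP.indep_sets (\<lambda>i. sigma_sets (space (M \<Otimes>\<^sub>M M)) (F i)) I \<longleftrightarrow>
    PP.indep_sets (\<lambda>i. {(\<lambda>(x, y). (X i x, X i y)) -` C \<inter> space (M \<Otimes>\<^sub>M M) | C. C \<in> sets (N i \<Otimes>\<^sub>M N i)}) I"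
  proof (intro PP.indep_sets_cong refl)
    fix i assume i: "i \<in> I"
    have "(\<lambda>(x, y). (X i x, X i y)) \<in> space (M \<Otimes>\<^sub>M M) \<rightarrow> space (N i) \<times> space (N i)"
      using measurable_space[OF Zm[OF i]] by (auto simp: space_pair_measure)
    from sigma_sets_vimage_commute[OF this, of "{A \<times> B | A B. A \<in> sets (N i) \<and> B \<in> sets (N i)}"]
    show "sigma_sets (space (M \<Otimes>\<^sub>M M)) (F i) = {(\<lambda>(x, y). (X i x, X i y)) -` C \<inter> space (M \<Otimes>\<^sub>M M) | C. C \<in> sets (N i \<Otimes>\<^sub>M N i)}"
      unfolding sets_pair_measure F_def by simp
  qed
  finally show ?thesis unfolding PP.indep_vars_def2 using Zm by blast
qed

lemma ennreal_cmult_less_top_D: "0 < e \<Longrightarrow> ennreal e * x < \<infinity> \<Longrightarrow> x < \<infinity>"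
  by (auto simp: ennreal_mult_less_top)

lemma nn_integral_finite_imp_AE:
  assumes "f \<in> borel_measurable N" "(\<integral>\<^sup>+ x. f x \<partial>N) < \<infinity>"
  shows "AE x in N. f x < (\<infinity>::ennreal)"
  using nn_integral_PInf_AE[of f N] assms by (auto simp: less_top)

section \<open>Transfer between the sequence and its symmetrization on the product space\<close>

locale indep_seq = prob_space M + weights a for M :: "'a measure" and a +
  fixes V :: "nat \<Rightarrow> 'a \<Rightarrow> 'b::{banach, second_countable_topology}"
  assumes indep_V: "indep_vars (\<lambda>_. borel) V {1..}"
begin

definition W :: "nat \<Rightarrow> 'a \<times> 'a \<Rightarrow> 'b" where "W n z = V n (fst z) - V n (snd z)"

lemma V_measurable [measurable]: "n \<ge> 1 \<Longrightarrow> V n \<in> borel_measurable M"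
  using indep_V by (auto simp: indep_vars_def)

lemma sumL_measurable [measurable]: "sumL a V \<in> borel_measurable M"
proof -
  have "(\<lambda>\<omega>. seqL a (\<lambda>i. V i \<omega>)) \<in> borel_measurable M" by (rule seqL_measurable) simp
  then show ?thesis by (simp add: sumL_eq_seqL[abs_def])
qed

lemma supN_V_measurable [measurable]: "supN a V \<in> borel_measurable M"
  by (rule supN_measurable) simp

sublocale pair: pair_prob_space M M ..

lemma W_measurable [measurable]: "n \<ge> 1 \<Longrightarrow> W n \<in> borel_measurable (M \<Otimes>\<^sub>M M)"
  unfolding W_def by measurable

text \<open>The second coordinate serves as the independent copy. Exchanging the coordinates
  preserves the product measure and turns \<open>W n\<close> into its negative, which is the
  symmetry.\<close>

sublocale sym: symmetric_seq "M \<Otimes>\<^sub>M M" a W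
proof
  have "prob_space.indep_vars (M \<Otimes>\<^sub>M M) (\<lambda>_. borel) (\<lambda>i z. (\<lambda>p. fst p - snd p) ((\<lambda>(x, y). (V i x, V i y)) z)) {1..}"
    by (rule  pair.P.indep_vars_compose2[OF indep_vars_pair_copy[OF indep_V]]) measurable
  also have "(\<lambda>i z. (\<lambda>p. fst p - snd p) ((\<lambda>(x, y). (V i x, V i y)) z)) = W"
    by (auto simp: fun_eq_iff W_def)
  finally show "prob_space.indep_vars (M \<Otimes>\<^sub>M M) (\<lambda>_. borel) W {1..}" .
next
  fix n :: nat assume n: "n \<ge> 1"
  note [measurable] = W_measurable[OF n]
  have "distr (M \<Otimes>\<^sub>M M) borel (W n)
     = distr (distr (M \<Otimes>\<^sub>M M) (M \<Otimes>\<^sub>M M) (\<lambda>(x, y). (y, x))) borel (W n)"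
    by (simp only: pair.distr_pair_swap[symmetric])
  also have "\<dots> = distr (M \<Otimes>\<^sub>M M) borel (W n \<circ> (\<lambda>(x, y). (y, x)))"
    by (rule distr_distr) measurable
  also have "W n \<circ> (\<lambda>(x, y). (y, x)) = (\<lambda>z. - W n z)"
    by (auto simp: fun_eq_iff W_def)
  finally show "distr (M \<Otimes>\<^sub>M M) borel (\<lambda>z. - W n z) = distr (M \<Otimes>\<^sub>M M) borel (W n)" ..
qed

lemma sym_L_le: "sym.L (x, y) \<le> sumL a V x + sumL a V y"
  unfolding sym.L_def sumL_eq_seqL W_def by (simp add: seqL_diff)

lemma supN_W_le: "supN a W (x, y) \<le> supN a V x + supN a V y"
  unfolding supN_def[of a W]
proof (rule SUP_least)
  fix n :: nat assume n: "n \<in> {1..}"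
  have "ennreal (tailsum a n * norm (W n (x, y))) \<le> ennreal (tailsum a n * norm (V n x) + tailsum a n * norm (V n y))"
    using n unfolding W_def distrib_left[symmetric]
    by (intro ennreal_leI mult_left_mono tailsum_nonneg) (auto intro: norm_triangle_ineq4)
  also have "\<dots> = ennreal (tailsum a n * norm (V n x)) + ennreal (tailsum a n * norm (V n y))"
    using n by (intro ennreal_plus mult_nonneg_nonneg tailsum_nonneg) auto
  also have "\<dots> \<le> supN a V x + supN a V y"
    unfolding supN_def using n by (intro add_mono SUP_upper) auto
  finally show "ennreal (tailsum a n * norm (W n (x, y))) \<le> supN a V x + supN a V y" .
qed

lemma AE_pairI:
  assumes "AE x in M. Q x"
  shows "AE z in M \<Otimes>\<^sub>M M. Q (fst z)" "AE z in M \<Otimes>\<^sub>M M. Q (snd z)"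
proof -
  have "AE x in distr (M \<Otimes>\<^sub>M M) M fst. Q x"
    using assms by (simp only: distr_pair_fst)
  then show fst: "AE z in M \<Otimes>\<^sub>M M. Q (fst z)" by (rule AE_distrD[rotated]) measurable
  have "AE z in distr (M \<Otimes>\<^sub>M M) (M \<Otimes>\<^sub>M M) (\<lambda>(x, y). (y, x)). Q (fst z)"
    using fst by (simp only: pair.distr_pair_swap[symmetric])
  then have "AE z in M \<Otimes>\<^sub>M M. Q (fst (case z of (x, y) \<Rightarrow> (y, x)))" by (rule AE_distrD[rotated]) measurable
  then show "AE z in M \<Otimes>\<^sub>M M. Q (snd z)" by (simp add: split_beta)
qed

lemma AE_sym_L_finite:
  assumes "AE \<omega> in M. sumL a V \<omega> < \<infinity>"
  shows "AE z in M \<Otimes>\<^sub>M M. sym.L z < \<infinity>"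
  using AE_pairI[OF assms]
proof eventually_elim
  case (elim z)
  then have "sumL a V (fst z) + sumL a V (snd z) < \<infinity>" by simp
  then show ?case using sym_L_le[of "fst z" "snd z"] by (simp add: le_less_trans)
qed

lemma nn_integral_pair_add:
  assumes [measurable]: "f \<in> borel_measurable M"
  shows "(\<integral>\<^sup>+ z. f (fst z) + f (snd z) \<partial>(M \<Otimes>\<^sub>M M)) = 2 * (\<integral>\<^sup>+ x. f x \<partial>M)"
proof -
  have "(\<integral>\<^sup>+ z. f (fst z) + f (snd z) \<partial>(M \<Otimes>\<^sub>M M)) = (\<integral>\<^sup>+x. (\<integral>\<^sup>+y. f x + f y \<partial>M) \<partial>M)"
    by (subst nn_integral_fst[symmetric]) auto
  also have "\<dots> = 2 * (\<integral>\<^sup>+ x. f x \<partial>M)"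
    by (simp add: nn_integral_add emeasure_space_1 mult_2)
  finally show ?thesis .
qed

text \<open>The weak symmetrization inequality, with \<open>c\<close> in the role of a median: the
  copy stays at or below \<open>c\<close> with probability at least \<open>1 - \<theta>\<close>,
  independently of the original, and then an original above \<open>t + c\<close> forces the
  difference above \<open>t\<close>. Uniformity of \<open>\<theta>\<close> in the index allows
  summation.\<close>

lemma Gam_symmetrization:
  assumes c: "\<And>n. n \<ge> 1 \<Longrightarrow> prob {\<omega>\<in>space M. tailsum a n * norm (V n \<omega>) > c} \<le> \<theta>" and \<theta>: "\<theta> < 1"
  shows "ennreal (1 - \<theta>) * Gam M a V (t + c) \<le> Gam (M \<Otimes>\<^sub>M M) a W t"
  unfolding Gam_def ennreal_suminf_cmult[symmetric]
proof (intro suminf_le summableI)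
  fix n
  let ?b = "tailsum a (Suc n)"
  let ?A = "{\<omega>\<in>space M. ?b * norm (V (Suc n) \<omega>) > t + c}" and ?C = "{\<omega>\<in>space M. ?b * norm (V (Suc n) \<omega>) > c}"
  have A [measurable]: "?A \<in> events" and C [measurable]: "?C \<in> events" by measurable
  have "prob ?A * (1 - \<theta>) \<le> prob ?A * prob (space M - ?C)"
    using c[of "Suc n"] by (intro mult_left_mono) (auto simp: prob_compl)
  also have "\<dots> = measure (M \<Otimes>\<^sub>M M) (?A \<times> (space M - ?C))"
    using emeasure_pair_measure_Times[OF A, of "space M - ?C"]
    by (simp add:  pair.P.emeasure_eq_measure emeasure_eq_measure ennreal_mult[symmetric])
  also have "\<dots> \<le> measure (M \<Otimes>\<^sub>M M) {z\<in>space (M \<Otimes>\<^sub>M M). ?b * norm (W (Suc n) z) > t}"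
  proof (rule  pair.P.finite_measure_mono)
    show "?A \<times> (space M - ?C) \<subseteq> {z\<in>space (M \<Otimes>\<^sub>M M). ?b * norm (W (Suc n) z) > t}"
    proof
      fix z assume z: "z \<in> ?A \<times> (space M - ?C)"
      have "?b * norm (V (Suc n) (fst z)) \<le> ?b * (norm (W (Suc n) z) + norm (V (Suc n) (snd z)))"
        unfolding W_def using tailsum_nonneg[of "Suc n"]
        by (intro mult_left_mono) (simp_all add: add.commute norm_triangle_sub)
      moreover have "t + c < ?b * norm (V (Suc n) (fst z))" "?b * norm (V (Suc n) (snd z)) \<le> c"
        using z by (auto simp: not_less)
      ultimately have "t < ?b * norm (W (Suc n) z)" by (simp add: distrib_left)
      then show "z \<in> {z\<in>space (M \<Otimes>\<^sub>M M). ?b * norm (W (Suc n) z) > t}"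
        using z by (auto simp: space_pair_measure)
    qed
    show "{z\<in>space (M \<Otimes>\<^sub>M M). ?b * norm (W (Suc n) z) > t} \<in>  sets (M \<Otimes>\<^sub>M M)" by measurable
  qed
  finally show "ennreal (1 - \<theta>) * ennreal (prob ?A)
     \<le> ennreal (measure (M \<Otimes>\<^sub>M M) {z\<in>space (M \<Otimes>\<^sub>M M). ?b * norm (W (Suc n) z) > t})"
    using \<theta> by (subst ennreal_mult[symmetric]) (auto intro!: ennreal_leI simp: mult.commute)
qed

text \<open>Finiteness of \<open>N\<close> for the difference sequence amounts to finiteness of its
  \<Gamma> at some level \<open>r\<close>; the transfer inequality passes this to \<open>V\<close>
  at level \<open>r + c\<close>, where the same equivalence is read backwards.\<close>

lemma AE_supN_finite:
  assumes c: "0 \<le> c" "\<And>n. n \<ge> 1 \<Longrightarrow> prob {\<omega>\<in>space M. tailsum a n * norm (V n \<omega>) > c} \<le> \<theta>" "\<theta> < 1"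
    and fin: "AE \<omega> in M. sumL a V \<omega> < \<infinity>"
  shows "AE \<omega> in M. supN a V \<omega> < \<infinity>"
proof -
  have "AE z in M \<Otimes>\<^sub>M M. supN a W z < \<infinity>"
    using sym.AE_S_finite[OF AE_sym_L_finite[OF fin]]
  proof eventually_elim
    case (elim z)
    then have "2 * sym.S z < \<infinity>" by (simp add: ennreal_mult_less_top)
    then show ?case by (rule le_less_trans[OF sym.supN_le_S])
  qed
  then obtain r where r: "r \<ge> 0" "Gam (M \<Otimes>\<^sub>M M) a W r < \<infinity>"
    using AE_supN_finite_iff[OF pair.P.prob_space_axioms sym.indep_W] by blast
  have "Gam M a V (r + c) < \<infinity>"
  proof (rule ennreal_cmult_less_top_D)
    show "0 < 1 - \<theta>" using c(3) by simp
    show "ennreal (1 - \<theta>) * Gam M a V (r + c) < \<infinity>"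
      by (rule le_less_trans[OF Gam_symmetrization[OF c(2,3)] r(2)])
  qed
  then show ?thesis
    using AE_supN_finite_iff[OF prob_space_axioms indep_V] r(1) c(1) by (metis add_nonneg_nonneg)
qed

lemma nn_integral_supN_finite:
  assumes c: "0 \<le> c" "\<And>n. n \<ge> 1 \<Longrightarrow> prob {\<omega>\<in>space M. tailsum a n * norm (V n \<omega>) > c} \<le> \<theta>" "\<theta> < 1"
    and fin: "(\<integral>\<^sup>+ \<omega>. sumL a V \<omega> \<partial>M) < \<infinity>"
  shows "(\<integral>\<^sup>+ \<omega>. supN a V \<omega> \<partial>M) < \<infinity>"
proof -
  have N_meas [measurable]: "supN a W \<in> borel_measurable (M \<Otimes>\<^sub>M M)" by (rule supN_measurable) simp
  \<comment> \<open>Altogether the mean of \<open>L\<close> is multiplied by 8: 2 for an entry as a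
    difference of two blocks, 2 from Levy's inequality, 2 from the two copies.\<close>
  have "(\<integral>\<^sup>+ z. supN a W z \<partial>(M \<Otimes>\<^sub>M M)) \<le> (\<integral>\<^sup>+ z. 2 * sym.S z \<partial>(M \<Otimes>\<^sub>M M))"
    by (intro nn_integral_mono sym.supN_le_S)
  also have "\<dots> = 2 * (\<integral>\<^sup>+ z. sym.S z \<partial>(M \<Otimes>\<^sub>M M))" by (rule nn_integral_cmult) measurable
  also have "\<dots> \<le> 2 * (2 * (\<integral>\<^sup>+ z. sym.L z \<partial>(M \<Otimes>\<^sub>M M)))"
    by (intro mult_left_mono sym.nn_integral_S_le) simp
  also have "(\<integral>\<^sup>+ z. sym.L z \<partial>(M \<Otimes>\<^sub>M M)) \<le> (\<integral>\<^sup>+ z. sumL a V (fst z) + sumL a V (snd z) \<partial>(M \<Otimes>\<^sub>M M))"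
    using sym_L_le by (intro nn_integral_mono) (auto simp: split_paired_all)
  also have "\<dots> = 2 * (\<integral>\<^sup>+ \<omega>. sumL a V \<omega> \<partial>M)" by (rule nn_integral_pair_add) measurable
  also have "2 * (2 * (2 * (\<integral>\<^sup>+ \<omega>. sumL a V \<omega> \<partial>M))) < \<infinity>"
    using fin by (simp add: ennreal_mult_less_top)
  finally have EN: "(\<integral>\<^sup>+ z. supN a W z \<partial>(M \<Otimes>\<^sub>M M)) < \<infinity>" by (simp add: mult_left_mono)
  let ?P = "\<lambda>t. emeasure (M \<Otimes>\<^sub>M M) {z\<in>space (M \<Otimes>\<^sub>M M). ennreal t < supN a W z}"
  \<comment> \<open>Adding \<open>c\<close> to the variable replaces the substitution
    \<open>t - c\<close> in the level, so that the integral of the shifted tail is again a layer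
    cake integral.\<close>
  let ?Pc = "\<lambda>t. emeasure (M \<Otimes>\<^sub>M M) {z\<in>space (M \<Otimes>\<^sub>M M). ennreal t < ennreal c + supN a W z}"
  have [measurable]: "?Pc \<in> borel_measurable borel" by measurable
  obtain r where r: "r \<ge> 0" "\<And>t. t \<ge> r \<Longrightarrow> Gam (M \<Otimes>\<^sub>M M) a W t \<le> 2 * ?P t"
    using Gam_le_two_tail[OF pair.P.prob_space_axioms sym.indep_W nn_integral_finite_imp_AE[OF N_meas EN]] by blast
  have "ennreal (1 - \<theta>) * Gam M a V t \<le> 2 * ?Pc t" if t: "r + c < t" for t
  proof -
    have "ennreal (1 - \<theta>) * Gam M a V t \<le> Gam (M \<Otimes>\<^sub>M M) a W (t - c)"
      using Gam_symmetrization[of c \<theta> "t - c", OF c(2,3)] by simp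
    also have "\<dots> \<le> 2 * ?P (t - c)" using t by (intro r(2)) simp
    also have "?P (t - c) \<le> ?Pc t"
    proof (rule emeasure_mono)
      show "{z\<in>space (M \<Otimes>\<^sub>M M). ennreal (t - c) < supN a W z} \<subseteq> {z\<in>space (M \<Otimes>\<^sub>M M). ennreal t < ennreal c + supN a W z}"
      proof safe
        fix x y assume "ennreal (t - c) < supN a W (x, y)"
        then have "ennreal c + ennreal (t - c) < ennreal c + supN a W (x, y)"
          by (subst ennreal_add_left_cancel_less) auto
        also have "ennreal c + ennreal (t - c) = ennreal t"
          using c(1) r(1) t by (subst ennreal_plus[symmetric]) auto
        finally show "ennreal t < ennreal c + supN a W (x, y)" .
      qed
    qed measurable
    finally show ?thesis by (simp add: mult_left_mono)
  qed
  then have "(\<integral>\<^sup>+ t. ennreal (1 - \<theta>) * (Gam M a V t * indicator {r+c<..} t) \<partial>lborel)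
     \<le> (\<integral>\<^sup>+ t. 2 * (?Pc t * indicator {0<..} t) \<partial>lborel)"
    using r(1) c(1) by (intro nn_integral_mono) (auto simp: indicator_def)
  also have "\<dots> = 2 * (\<integral>\<^sup>+ t\<in>{0<..}. ?Pc t \<partial>lborel)" by (rule nn_integral_cmult) measurable
  also have "(\<integral>\<^sup>+ t\<in>{0<..}. ?Pc t \<partial>lborel) = (\<integral>\<^sup>+ z. ennreal c + supN a W z \<partial>(M \<Otimes>\<^sub>M M))"
    by (intro nn_integral_layer_cake[symmetric] pair.P.sigma_finite_measure_axioms) measurable
  also have "\<dots> = ennreal c + (\<integral>\<^sup>+ z. supN a W z \<partial>(M \<Otimes>\<^sub>M M))"
    by (subst nn_integral_add) (auto simp: pair.P.emeasure_space_1)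
  finally have *: "(\<integral>\<^sup>+ t. ennreal (1 - \<theta>) * (Gam M a V t * indicator {r+c<..} t) \<partial>lborel) < \<infinity>"
    by (rule le_less_trans) (use EN in \<open>simp add: ennreal_mult_less_top\<close>)
  have "(\<integral>\<^sup>+ t. ennreal (1 - \<theta>) * (Gam M a V t * indicator {r+c<..} t) \<partial>lborel)
     = ennreal (1 - \<theta>) * (\<integral>\<^sup>+ t\<in>{r+c<..}. Gam M a V t \<partial>lborel)"
  proof (rule nn_integral_cmult)
    have "Gam M a V \<in> borel_measurable borel"
    proof -
      have "(\<lambda>t. ennreal (prob {\<omega>\<in>space M. tailsum a (Suc n) * norm (V (Suc n) \<omega>) > t})) \<in> borel_measurable borel" for n
        unfolding emeasure_eq_measure[symmetric] by measurable
      then show ?thesis unfolding Gam_def[abs_def] by (rule borel_measurable_suminf_order)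
    qed
    then show "(\<lambda>t. Gam M a V t * indicator {r+c<..} t) \<in> borel_measurable lborel" by measurable
  qed
  from *[unfolded this] have "(\<integral>\<^sup>+ t\<in>{r+c<..}. Gam M a V t \<partial>lborel) < \<infinity>"
    by (rule ennreal_cmult_less_top_D[rotated]) (use c(3) in simp)
  then have "\<exists>r\<ge>0. (\<integral>\<^sup>+ t\<in>{r<..}. Gam M a V t \<partial>lborel) < \<infinity>"
    using r(1) c(1) by (intro exI[of _ "r + c"] conjI add_nonneg_nonneg)
  then show ?thesis
    by (rule iffD2[OF nn_integral_supN_finite_iff[OF prob_space_axioms indep_V]])
qed

text \<open>The symmetrized sum is integrable by Hoffmann-Jorgensen, so by Fubini some translate
  \<open>V - V(y)\<close> has integrable \<open>L\<close>, and \<open>y\<close> can be chosen with \<open>L(V(y))\<close> finite.\<close>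

lemma nn_integral_sumL_finite:
  assumes fin: "AE \<omega> in M. sumL a V \<omega> < \<infinity>" and N: "(\<integral>\<^sup>+ \<omega>. supN a V \<omega> \<partial>M) < \<infinity>"
  shows "(\<integral>\<^sup>+ \<omega>. sumL a V \<omega> \<partial>M) < \<infinity>"
proof -
  have "(\<integral>\<^sup>+ z. supN a W z \<partial>(M \<Otimes>\<^sub>M M)) \<le> (\<integral>\<^sup>+ z. supN a V (fst z) + supN a V (snd z) \<partial>(M \<Otimes>\<^sub>M M))"
    using supN_W_le by (intro nn_integral_mono) (auto simp: split_paired_all)
  also have "\<dots> = 2 * (\<integral>\<^sup>+ \<omega>. supN a V \<omega> \<partial>M)" by (rule nn_integral_pair_add) measurable
  also have "\<dots> < \<infinity>" using N by (simp add: ennreal_mult_less_top)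
  finally have "(\<integral>\<^sup>+ z. sym.S z \<partial>(M \<Otimes>\<^sub>M M)) < \<infinity>"
    by (rule sym.nn_integral_S_finite[OF AE_sym_L_finite[OF fin]])
  then have "(\<integral>\<^sup>+ z. sym.L z \<partial>(M \<Otimes>\<^sub>M M)) < \<infinity>"
    by (rule le_less_trans[rotated]) (intro nn_integral_mono sym.L_le_S)
  then have "(\<integral>\<^sup>+ y. (\<integral>\<^sup>+ x. sym.L (x, y) \<partial>M) \<partial>M) < \<infinity>"
    by (subst pair.nn_integral_snd) auto
  then have "AE y in M. (\<integral>\<^sup>+ x. sym.L (x, y) \<partial>M) < \<infinity>"
    by (rule nn_integral_finite_imp_AE[rotated]) measurable
  with fin have "AE y in M. (\<integral>\<^sup>+ x. sym.L (x, y) \<partial>M) < \<infinity> \<and> sumL a V y < \<infinity>"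
    by eventually_elim simp
  then obtain y where y: "(\<integral>\<^sup>+ x. sym.L (x, y) \<partial>M) < \<infinity>" "sumL a V y < \<infinity>" "y \<in> space M"
    using eventually_happens'[OF ae_filter_bot AE_conjI[OF _ AE_space]] by blast
  have "sumL a V x \<le> sym.L (x, y) + sumL a V y" for x
    using seqL_add[of "\<lambda>i. W i (x, y)" "\<lambda>i. V i y"] by (simp add: sym.L_def sumL_eq_seqL W_def)
  then have "(\<integral>\<^sup>+ x. sumL a V x \<partial>M) \<le> (\<integral>\<^sup>+ x. sym.L (x, y) + sumL a V y \<partial>M)"
    by (intro nn_integral_mono)
  also have "\<dots> = (\<integral>\<^sup>+ x. sym.L (x, y) \<partial>M) + sumL a V y"
    using y(3) by (subst nn_integral_add) (auto simp: emeasure_space_1)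
  also have "\<dots> < \<infinity>" using y by simp
  finally show ?thesis .
qed

end

section \<open>Centered moments and the lower limit\<close>

text \<open>Jensen with one variable frozen: \<open>x\<close> is the mean of \<open>x + Y\<close>,
  so its norm is at most the mean of the norms. Working with the laws of \<open>X\<close> and
  \<open>Y\<close> lets Fubini integrate this over \<open>x\<close>.\<close>

lemma (in prob_space) expectation_norm_le_norm_add:
  fixes X Y :: "'a \<Rightarrow> 'b::{banach, second_countable_topology}"
  assumes ind: "indep_var borel X borel Y" and X: "integrable M X" and Y: "integrable M Y"
    and Y0: "expectation Y = 0"
  shows "expectation (\<lambda>\<omega>. norm (X \<omega>)) \<le> expectation (\<lambda>\<omega>. norm (X \<omega> + Y \<omega>))"
proof -
  note [measurable] = borel_measurable_integrable[OF X] borel_measurable_integrable[OF Y]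
  define \<mu> where "\<mu> = distr M borel X"
  define \<nu> where "\<nu> = distr M borel Y"
  interpret \<mu>: prob_space \<mu> unfolding \<mu>_def by (rule prob_space_distr) measurable
  interpret \<nu>: prob_space \<nu> unfolding \<nu>_def by (rule prob_space_distr) measurable
  interpret pr: pair_prob_space \<mu> \<nu> ..
  have sets [measurable_cong]: "sets \<mu> = sets borel" "sets \<nu> = sets borel" by (auto simp: \<mu>_def \<nu>_def)
  have joint: "\<mu> \<Otimes>\<^sub>M \<nu> = distr M (borel \<Otimes>\<^sub>M borel) (\<lambda>\<omega>. (X \<omega>, Y \<omega>))"
    using ind unfolding \<mu>_def \<nu>_def indep_var_distribution_eq by blast
  have [measurable]: "(\<lambda>z. norm (fst z + snd z)) \<in> borel_measurable (borel \<Otimes>\<^sub>M borel :: ('b \<times> 'b) measure)"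
    by measurable
  have int: "integrable (\<mu> \<Otimes>\<^sub>M \<nu>) (\<lambda>z. norm (fst z + snd z))"
    unfolding joint by (subst integrable_distr_eq) (auto intro!: integrable_norm X Y)
  have int_y: "integrable \<nu> (\<lambda>y. y)"
    unfolding \<nu>_def by (subst integrable_distr_eq) (auto intro: Y)
  have int_x: "integrable \<mu> (\<lambda>x. norm x)"
    unfolding \<mu>_def by (subst integrable_distr_eq) (auto intro: X integrable_norm)
  have mean: "(\<integral>y. y \<partial>\<nu>) = 0"
    unfolding \<nu>_def by (subst integral_distr) (auto simp: Y0)
  have "expectation (\<lambda>\<omega>. norm (X \<omega>)) = (\<integral>x. norm x \<partial>\<mu>)"
    unfolding \<mu>_def by (subst integral_distr) auto
  also have "\<dots> \<le> (\<integral>x. (\<integral>y. norm (x + y) \<partial>\<nu>) \<partial>\<mu>)"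
  proof (rule integral_mono[OF int_x])
    show "integrable \<mu> (\<lambda>x. \<integral>y. norm (x + y) \<partial>\<nu>)"
      using pr.integrable_fst'[OF int] by simp
    fix x
    have "norm x = norm (\<integral>y. x + y \<partial>\<nu>)"
      using int_y mean \<nu>.prob_space by (simp add: Bochner_Integration.integral_add)
    also have "\<dots> \<le> (\<integral>y. norm (x + y) \<partial>\<nu>)" by (rule integral_norm_bound)
    finally show "norm x \<le> (\<integral>y. norm (x + y) \<partial>\<nu>)" .
  qed
  also have "\<dots> = (\<integral>z. norm (fst z + snd z) \<partial>(\<mu> \<Otimes>\<^sub>M \<nu>))"
    using pr.integral_fst'[OF int] by simp
  also have "\<dots> = expectation (\<lambda>\<omega>. norm (X \<omega> + Y \<omega>))"
    unfolding joint by (subst integral_distr) auto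
  finally show ?thesis .
qed

text \<open>In the sum of the first \<open>Suc K\<close> tail sums, \<open>a (Suc n)\<close> occurs
  once for each \<open>k\<close> up to both \<open>K\<close> and \<open>n\<close>, hence at most
  \<open>Suc n\<close> times.\<close>

lemma (in weights) summable_tailsum:
  assumes "summable (\<lambda>n. real (Suc n) * a (Suc n))"
  shows "summable (\<lambda>n. tailsum a (Suc n))"
proof (rule bounded_imp_summable[where B="\<Sum>n. real (Suc n) * a (Suc n)"])
  show "0 \<le> tailsum a (Suc n)" for n by (rule tailsum_nonneg) simp
  fix K
  have tail: "(\<lambda>n. if k \<le> n then a (Suc n) else 0) sums tailsum a (Suc k)" for k
  proof -
    have "(\<lambda>n. a (Suc (n + k))) sums tailsum a (Suc k)"
      using summable_sums[OF summable_tail[of "Suc k"]] by (simp add: tailsum_def add.commute)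
    then show ?thesis
      using sums_iff_shift'[of "\<lambda>n. if k \<le> n then a (Suc n) else 0" k] 
      by (simp add: sums_iff_shift)
  qed
  have "(\<lambda>n. \<Sum>k\<le>K. if k \<le> n then a (Suc n) else 0) sums (\<Sum>k\<le>K. tailsum a (Suc k))"
    by (intro sums_sum tail)
  moreover have "(\<Sum>k\<le>K. if k \<le> n then a (Suc n) else 0) \<le> real (Suc n) * a (Suc n)" for n
  proof -
    have "(\<Sum>k\<le>K. if k \<le> n then a (Suc n) else 0) = (\<Sum>k\<in>{..K} \<inter> {..n}. a (Suc n))"
      by (subst sum.inter_restrict) auto
    also have "\<dots> \<le> (\<Sum>k\<le>n. a (Suc n))"
      by (intro sum_mono2) (auto intro: a_nonneg)
    finally show ?thesis by simp
  qed
  ultimately show "(\<Sum>k\<le>K. tailsum a (Suc k)) \<le> (\<Sum>n. real (Suc n) * a (Suc n))"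
    using assms by (intro sums_le[OF _ _ summable_sums]) auto
qed

text \<open>A pointwise argument: a positive lower limit gives an eventual bound
  \<open>\<delta> * n\<close> below the norm of the partial sums, so the finite value of
  \<open>L\<close> dominates the series of n a_n, and the tail sums would be summable.\<close>

lemma (in weights) liminf_psum_eq_0:
  assumes nsum: "\<not> summable (\<lambda>n. tailsum a (Suc n))" and fin: "sumL a V \<omega> < \<infinity>"
  shows "liminf (\<lambda>n. ereal (norm (psum V n \<omega>) / real n)) = 0"
proof (rule antisym)
  show "0 \<le> liminf (\<lambda>n. ereal (norm (psum V n \<omega>) / real n))"
    by (intro Liminf_bounded) (auto intro!: always_eventually)
  show "liminf (\<lambda>n. ereal (norm (psum V n \<omega>) / real n)) \<le> 0"
  proof (rule ccontr)
    assume "\<not> liminf (\<lambda>n. ereal (norm (psum V n \<omega>) / real n)) \<le> 0"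
    then have "0 < liminf (\<lambda>n. ereal (norm (psum V n \<omega>) / real n))" by simp
    then obtain \<delta> where \<delta>: "0 < ereal \<delta>" "ereal \<delta> < liminf (\<lambda>n. ereal (norm (psum V n \<omega>) / real n))"
      using ereal_dense2 by blast
    then have "\<forall>\<^sub>F n in sequentially. ereal \<delta> < ereal (norm (psum V n \<omega>) / real n)"
      by (intro less_LiminfD)
    then have "\<forall>\<^sub>F n in sequentially. \<delta> < norm (psum V n \<omega>) / real n" by simp
    then have ev: "\<forall>\<^sub>F n in sequentially. \<delta> < norm (psum V (Suc n) \<omega>) / real (Suc n)"
      by (subst eventually_sequentially_Suc[of "\<lambda>n. \<delta> < norm (psum V n \<omega>) / real n"])
    have "summable (\<lambda>n. a (Suc n) * norm (psum V (Suc n) \<omega>))"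
      using fin unfolding sumL_def
      by (intro summable_suminf_not_top mult_nonneg_nonneg a_nonneg) auto
    moreover have "\<forall>\<^sub>F n in sequentially. norm (\<delta> * (real (Suc n) * a (Suc n))) \<le> a (Suc n) * norm (psum V (Suc n) \<omega>)"
      using ev
    proof eventually_elim
      case (elim n)
      then have "\<delta> * real (Suc n) \<le> norm (psum V (Suc n) \<omega>)" by (simp add: field_simps)
      then have "(\<delta> * real (Suc n)) * a (Suc n) \<le> norm (psum V (Suc n) \<omega>) * a (Suc n)"
        by (intro mult_right_mono a_nonneg) auto
      moreover have "norm (\<delta> * (real (Suc n) * a (Suc n))) = \<delta> * real (Suc n) * a (Suc n)"
        using \<delta>(1) a_nonneg[of "Suc n"] by (simp add: abs_mult)
      ultimately show ?case by (simp add: mult_ac)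
    qed
    ultimately have "summable (\<lambda>n. \<delta> * (real (Suc n) * a (Suc n)))"
      by (rule summable_comparison_test_ev[rotated])
    then have "summable (\<lambda>n. real (Suc n) * a (Suc n))"
      using \<delta>(1) by (subst (asm) summable_cmult_iff) auto
    then show False using summable_tailsum nsum by blast
  qed
qed

section \<open>Decay of the weighted centered means\<close>

context indep_seq begin

lemma psum_measurable [measurable]: "psum V n \<in> borel_measurable M"
  unfolding psum_def[abs_def] by (rule borel_measurable_sum) simp

lemma integrable_V:
  assumes N: "(\<integral>\<^sup>+ \<omega>. supN a V \<omega> \<partial>M) < \<infinity>" and n: "n \<ge> 1" "tailsum a n > 0"
  shows "integrable M (V n)"
proof (rule integrableI_bounded)
  show "V n \<in> borel_measurable M" using n(1) by simp
  have "ennreal (tailsum a n) * (\<integral>\<^sup>+ \<omega>. ennreal (norm (V n \<omega>)) \<partial>M) = (\<integral>\<^sup>+ \<omega>. ennreal (tailsum a n * norm (V n \<omega>)) \<partial>M)"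
    using n by (subst nn_integral_cmult[symmetric]) (auto simp: ennreal_mult')
  also have "\<dots> \<le> (\<integral>\<^sup>+ \<omega>. supN a V \<omega> \<partial>M)"
    unfolding supN_def using n(1) by (intro nn_integral_mono SUP_upper) auto
  finally have "ennreal (tailsum a n) * (\<integral>\<^sup>+ \<omega>. ennreal (norm (V n \<omega>)) \<partial>M) < \<infinity>"
    using N by (rule le_less_trans)
  then show "(\<integral>\<^sup>+ \<omega>. ennreal (norm (V n \<omega>)) \<partial>M) < \<infinity>"
    by (rule ennreal_cmult_less_top_D[OF n(2)])
qed

lemma integrable_psum:
  assumes "\<And>i. 1 \<le> i \<Longrightarrow> i \<le> n \<Longrightarrow> integrable M (V i)"
  shows "integrable M (psum V n)"
  unfolding psum_def[abs_def] using assms by (intro Bochner_Integration.integrable_sum) auto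

text \<open>The later centered sum is the earlier one plus an independent block of mean zero, which
  cannot decrease the mean norm.\<close>

lemma expectation_centered_mono:
  assumes int: "\<And>i. 1 \<le> i \<Longrightarrow> i \<le> k \<Longrightarrow> integrable M (V i)" and nk: "n \<le> k"
  shows "expectation (\<lambda>\<omega>. norm (psum V n \<omega> - expectation (psum V n)))
    \<le> expectation (\<lambda>\<omega>. norm (psum V k \<omega> - expectation (psum V k)))"
proof -
  define d where "d = expectation (psum V k) - expectation (psum V n)"
  define X where "X \<omega> = psum V n \<omega> - expectation (psum V n)" for \<omega>
  define Y where "Y \<omega> = (\<Sum>i\<in>{n<..k}. V i \<omega>) - d" for \<omega>
  have split: "psum V k \<omega> = psum V n \<omega> + (\<Sum>i\<in>{n<..k}. V i \<omega>)" for \<omega>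
  proof -
    have "{1..k} = {1..n} \<union> {n<..k}" using nk by auto
    moreover have "(\<Sum>i\<in>{1..n} \<union> {n<..k}. V i \<omega>) = (\<Sum>i\<in>{1..n}. V i \<omega>) + (\<Sum>i\<in>{n<..k}. V i \<omega>)"
      by (rule sum.union_disjoint) auto
    ultimately show ?thesis unfolding psum_def by metis
  qed
  have ik: "integrable M (psum V k)" "integrable M (psum V n)"
    using int nk by (auto intro!: integrable_psum)
  have Ydef: "Y \<omega> = psum V k \<omega> - psum V n \<omega> - d" for \<omega> unfolding Y_def split by simp
  have X: "integrable M X" and Y: "integrable M Y"
    unfolding X_def Ydef using ik by auto
  have Y0: "expectation Y = 0"
    unfolding Ydef using ik by (simp add: d_def prob_space)
  have "indep_var borel ((\<lambda>w. (\<Sum>i\<in>{1..n}. w i) - expectation (psum V n)) \<circ> (\<lambda>\<omega>. \<lambda>i\<in>{1..n}. V i \<omega>))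
    borel ((\<lambda>w. (\<Sum>i\<in>{n<..k}. w i) - d) \<circ> (\<lambda>\<omega>. \<lambda>i\<in>{n<..k}. V i \<omega>))"
    by (rule indep_var_compose[OF indep_var_restrict[OF indep_V]]) auto
  also have "(\<lambda>w. (\<Sum>i\<in>{1..n}. w i) - expectation (psum V n)) \<circ> (\<lambda>\<omega>. \<lambda>i\<in>{1..n}. V i \<omega>) = X"
    by (auto simp: X_def psum_def fun_eq_iff)
  also have "(\<lambda>w. (\<Sum>i\<in>{n<..k}. w i) - d) \<circ> (\<lambda>\<omega>. \<lambda>i\<in>{n<..k}. V i \<omega>) = Y"
    by (auto simp: Y_def fun_eq_iff)
  finally have "expectation (\<lambda>\<omega>. norm (X \<omega>)) \<le> expectation (\<lambda>\<omega>. norm (X \<omega> + Y \<omega>))"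
    using X Y Y0 by (rule expectation_norm_le_norm_add)
  then show ?thesis by (simp add: X_def Ydef d_def algebra_simps)
qed

text \<open>Write b_n c_n as the sum of a_k c_n over k >= n. Monotonicity replaces c_n by c_k, and
  centering costs a factor 2, so the whole is at most twice a tail of the series of the
  \<open>e k\<close>, whose sum is the mean of \<open>L\<close>.\<close>

lemma tailsum_expectation_tendsto_0:
  assumes L: "(\<integral>\<^sup>+ \<omega>. sumL a V \<omega> \<partial>M) < \<infinity>" and N: "(\<integral>\<^sup>+ \<omega>. supN a V \<omega> \<partial>M) < \<infinity>"
  shows "(\<lambda>n. if tailsum a n = 0 then 0
            else tailsum a n * expectation (\<lambda>\<omega>. norm (psum V n \<omega> - expectation (psum V n)))) \<longlonglongrightarrow> 0"
proof -
  define e where "e n = a n * expectation (\<lambda>\<omega>. norm (psum V n \<omega>))" for n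
  define c where "c n = expectation (\<lambda>\<omega>. norm (psum V n \<omega> - expectation (psum V n)))" for n
  \<comment> \<open>Tail sums decrease, so a positive one at \<open>n\<close> makes all earlier ones
    positive.\<close>
  have int: "integrable M (V i)" if "1 \<le> i" "i \<le> n" "tailsum a n > 0" for i n
    using that tailsum_antimono[of i n] by (intro integrable_V[OF N]) auto
  have int_psum: "integrable M (psum V n)" if "n \<ge> 1" "tailsum a n > 0" for n
    using int that by (intro integrable_psum) auto
  have pos: "tailsum a n > 0" if "n \<ge> 1" "a n > 0" for n
    using tailsum_ge_term[of n n] that by simp
  have e_nn: "0 \<le> e n" if "n \<ge> 1" for n using a_nonneg[OF that] by (simp add: e_def)
  have summable_e: "summable (\<lambda>n. e (Suc n))"
  proof (rule summable_suminf_not_top)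
    have "(\<integral>\<^sup>+ \<omega>. sumL a V \<omega> \<partial>M) = (\<Sum>n. \<integral>\<^sup>+ \<omega>. ennreal (a (Suc n) * norm (psum V (Suc n) \<omega>)) \<partial>M)"
      unfolding sumL_def by (rule nn_integral_suminf) measurable
    also have "\<dots> = (\<Sum>n. ennreal (e (Suc n)))"
    proof (rule suminf_cong)
      fix n
      show "(\<integral>\<^sup>+ \<omega>. ennreal (a (Suc n) * norm (psum V (Suc n) \<omega>)) \<partial>M) = ennreal (e (Suc n))"
      \<comment> \<open>With weight 0 the partial sum need not be integrable, but both sides vanish.
        A positive weight makes the tail sum positive, which gives integrability.\<close>
      proof (cases "a (Suc n) = 0")
        case False
        then have "a (Suc n) > 0" using a_nonneg[of "Suc n"] by simp
        then have "integrable M (psum V (Suc n))" using pos int_psum by auto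
        then show ?thesis
          using a_nonneg[of "Suc n"] by (subst nn_integral_eq_integral) (auto simp: e_def)
      qed (simp add: e_def)
    qed
    finally show "(\<Sum>n. ennreal (e (Suc n))) \<noteq> \<top>" using L by simp
  qed (simp add: e_nn)
  have bound: "tailsum a n * c n \<le> 2 * (\<Sum>i. e (n + i))" if n: "n \<ge> 1" "tailsum a n > 0" for n
  proof -
    have "a k * c n \<le> 2 * e k" if k: "n \<le> k" for k
    proof (cases "a k = 0")
      case False
      then have ak: "a k > 0" using a_nonneg[of k] n k by simp
      then have bk: "tailsum a k > 0" using pos n k by simp
      have ik: "integrable M (psum V k)" using int_psum bk n k by simp
      have "c n \<le> c k"
        unfolding c_def using int[OF _ _ bk] k by (intro expectation_centered_mono) auto
      also have "\<dots> \<le> expectation (\<lambda>\<omega>. norm (psum V k \<omega>) + norm (expectation (psum V k)))"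
        unfolding c_def using ik by (intro integral_mono) (auto intro: norm_triangle_ineq4)
      also have "\<dots> = expectation (\<lambda>\<omega>. norm (psum V k \<omega>)) + norm (expectation (psum V k))"
        using ik by (simp add: prob_space)
      also have "\<dots> \<le> 2 * expectation (\<lambda>\<omega>. norm (psum V k \<omega>))"
        using integral_norm_bound[of M "psum V k"] by simp
      finally have "a k * c n \<le> a k * (2 * expectation (\<lambda>\<omega>. norm (psum V k \<omega>)))"
        using ak by (intro mult_left_mono) auto
      then show ?thesis by (simp add: e_def)
    qed (simp add: e_def)
    moreover have se: "summable (\<lambda>i. e (n + i))"
      using summable_ignore_initial_segment[OF summable_e, of "n - 1"] n by (simp add: add.commute)
    ultimately have "(\<Sum>i. a (n + i) * c n) \<le> (\<Sum>i. 2 * e (n + i))"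
      using n by (intro suminf_le summable_mult summable_mult2 summable_tail) auto
    also have "(\<Sum>i. a (n + i) * c n) = tailsum a n * c n"
      unfolding tailsum_def using n by (subst suminf_mult2) (auto intro: summable_tail)
    also have "(\<Sum>i. 2 * e (n + i)) = 2 * (\<Sum>i. e (n + i))" by (rule suminf_mult[OF se])
    finally show ?thesis .
  qed
  have "(\<lambda>n. \<Sum>i. e (Suc (i + n))) \<longlonglongrightarrow> 0"
  proof -
    have "(\<lambda>n. (\<Sum>i. e (Suc i)) - (\<Sum>i<n. e (Suc i))) \<longlonglongrightarrow> (\<Sum>i. e (Suc i)) - (\<Sum>i. e (Suc i))"
      by (intro tendsto_diff tendsto_const summable_LIMSEQ summable_e)
    then show ?thesis using suminf_minus_initial_segment[OF summable_e] by simp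
  qed
  then have lim: "(\<lambda>n. 2 * (\<Sum>i. e (Suc n + i))) \<longlonglongrightarrow> 0"
    by (intro tendsto_mult_right_zero) (simp add: add.commute)
  \<comment> \<open>Shifted by one because the tail sum at index 0 contains the unconstrained value
    \<open>a 0\<close>; the limit does not see it.\<close>
  have "(\<lambda>n. if tailsum a (Suc n) = 0 then 0 else tailsum a (Suc n) * c (Suc n)) \<longlonglongrightarrow> 0"
  proof (rule tendsto_sandwich[OF always_eventually always_eventually tendsto_const lim]; intro allI)
    fix n
    have b: "0 \<le> tailsum a (Suc n)" by (rule tailsum_nonneg) simp
    then show "0 \<le> (if tailsum a (Suc n) = 0 then 0 else tailsum a (Suc n) * c (Suc n))"
      by (simp add: c_def)
    have "summable (\<lambda>i. e (Suc n + i))"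
      using summable_ignore_initial_segment[OF summable_e, of n] by (simp add: add.commute)
    then have "0 \<le> (\<Sum>i. e (Suc n + i))" by (intro suminf_nonneg e_nn) auto
    then show "(if tailsum a (Suc n) = 0 then 0 else tailsum a (Suc n) * c (Suc n)) \<le> 2 * (\<Sum>i. e (Suc n + i))"
      using bound[of "Suc n"] b by simp
  qed
  then show ?thesis unfolding c_def by (subst filterlim_sequentially_Suc[symmetric])
qed

end

text \<open>Means of vectors are Bochner integrals, which agree with Pettis integrals once the norm
  is integrable. In (d), when b_n > 0 for some n >= 1, all V_i with 1 <= i <= n are integrable, so
  the mean of T_n there is a genuine one.\<close>

theorem theorem3p1:
  fixes M :: "'a measure"
    and V :: "nat \<Rightarrow> 'a \<Rightarrow> 'b::{banach, second_countable_topology}"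
    and a :: "nat \<Rightarrow> real"
  assumes "prob_space M"
    and indep: "prob_space.indep_vars M (\<lambda>_. borel) V {1..}"
    and rv: "\<And>n. n \<ge> 1 \<Longrightarrow> V n \<in> borel_measurable M"
    and a_nonneg: "\<And>n. n \<ge> 1 \<Longrightarrow> a n \<ge> 0"
    and a_summable: "summable (\<lambda>n. a (Suc n))"
  shows "(\<forall>\<omega>\<in>space M. sumL a V \<omega> \<le> sumM a V \<omega>)
    \<and> ((\<exists>c\<ge>0. (SUP n\<in>{1..}. measure M {\<omega>\<in>space M. tailsum a n * norm (V n \<omega>) > c}) < 1) \<longrightarrow>
      ( (((AE \<omega> in M. sumL a V \<omega> < \<infinity>) \<longrightarrow> (AE \<omega> in M. supN a V \<omega> < \<infinity>))
          \<and> ((AE \<omega> in M. supN a V \<omega> < \<infinity>) \<longleftrightarrow> (INF r\<in>{0..}. Gam M a V r) < \<infinity>))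
      \<and> ((\<integral>\<^sup>+ \<omega>. supN a V \<omega> \<partial>M) < \<infinity> \<longleftrightarrow>
           (\<exists>r\<ge>0. (\<integral>\<^sup>+ t\<in>{r<..}. Gam M a V t \<partial>lborel) < \<infinity>))
      \<and> ((\<integral>\<^sup>+ \<omega>. sumL a V \<omega> \<partial>M) < \<infinity> \<longleftrightarrow>
           ((AE \<omega> in M. sumL a V \<omega> < \<infinity>) \<and> (\<integral>\<^sup>+ \<omega>. supN a V \<omega> \<partial>M) < \<infinity>))
      \<and> ((\<integral>\<^sup>+ \<omega>. sumL a V \<omega> \<partial>M) < \<infinity> \<longrightarrow>
           (\<forall>n\<ge>1. tailsum a n > 0 \<longrightarrow> integrable M (\<lambda>\<omega>. norm (V n \<omega>)))
           \<and> ((\<lambda>n. if tailsum a n = 0 then 0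
                    else tailsum a n * (\<integral>\<omega>. norm (psum V n \<omega> - (\<integral>x. psum V n x \<partial>M)) \<partial>M))
               \<longlonglongrightarrow> 0))
      \<and> ((\<not> summable (\<lambda>n. tailsum a (Suc n)) \<and> (AE \<omega> in M. sumL a V \<omega> < \<infinity>)) \<longrightarrow>
           (AE \<omega> in M. liminf (\<lambda>n. ereal (norm (psum V n \<omega>) / real n)) = 0))))"
proof -
  interpret prob_space M by fact
  interpret indep_seq M a V
    by unfold_locales (use assms in auto)
  show ?thesis
  proof (intro conjI impI)
    show "\<forall>\<omega>\<in>space M. sumL a V \<omega> \<le> sumM a V \<omega>" by (intro ballI sumL_le_sumM)
  next
    assume "\<exists>c\<ge>0. (SUP n\<in>{1..}. measure M {\<omega>\<in>space M. tailsum a n * norm (V n \<omega>) > c}) < 1"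
    then obtain c where c: "c \<ge> 0" and \<theta>: "(SUP n\<in>{1..}. measure M {\<omega>\<in>space M. tailsum a n * norm (V n \<omega>) > c}) < 1"
      by blast
    \<comment> \<open>The supremum itself serves as \<open>\<theta>\<close>; being a real supremum,
      it bounds its terms because probabilities are bounded by 1.\<close>
    have le: "measure M {\<omega>\<in>space M. tailsum a n * norm (V n \<omega>) > c} 
        \<le> (SUP n\<in>{1..}. measure M {\<omega>\<in>space M. tailsum a n * norm (V n \<omega>) > c})" if "n \<ge> 1" for n
      using that by (intro cSUP_upper) (auto intro!: bdd_aboveI[where M=1])
    have EN: "(\<integral>\<^sup>+ \<omega>. supN a V \<omega> \<partial>M) < \<infinity>" if "(\<integral>\<^sup>+ \<omega>. sumL a V \<omega> \<partial>M) < \<infinity>"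
      using le that by (rule nn_integral_supN_finite[OF c _ \<theta>])
    { assume "AE \<omega> in M. sumL a V \<omega> < \<infinity>"
      with le show "AE \<omega> in M. supN a V \<omega> < \<infinity>" by (rule AE_supN_finite[OF c _ \<theta>]) }
    show "(AE \<omega> in M. supN a V \<omega> < \<infinity>) \<longleftrightarrow> (INF r\<in>{0..}. Gam M a V r) < \<infinity>"
      unfolding AE_supN_finite_iff[OF prob_space_axioms indep_V] INF_less_iff by auto
    show "(\<integral>\<^sup>+ \<omega>. supN a V \<omega> \<partial>M) < \<infinity> \<longleftrightarrow> (\<exists>r\<ge>0. (\<integral>\<^sup>+ t\<in>{r<..}. Gam M a V t \<partial>lborel) < \<infinity>)"
      by (rule nn_integral_supN_finite_iff[OF prob_space_axioms indep_V])
    show "(\<integral>\<^sup>+ \<omega>. sumL a V \<omega> \<partial>M) < \<infinity> \<longleftrightarrow>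
           ((AE \<omega> in M. sumL a V \<omega> < \<infinity>) \<and> (\<integral>\<^sup>+ \<omega>. supN a V \<omega> \<partial>M) < \<infinity>)"
      using EN nn_integral_sumL_finite nn_integral_finite_imp_AE[OF sumL_measurable] by blast
    { assume "(\<integral>\<^sup>+ \<omega>. sumL a V \<omega> \<partial>M) < \<infinity>"
      from EN[OF this] show "\<forall>n\<ge>1. tailsum a n > 0 \<longrightarrow> integrable M (\<lambda>\<omega>. norm (V n \<omega>))"
        using integrable_V by blast }
    { assume L: "(\<integral>\<^sup>+ \<omega>. sumL a V \<omega> \<partial>M) < \<infinity>"
      show "(\<lambda>n. if tailsum a n = 0 then 0
                    else tailsum a n * (\<integral>\<omega>. norm (psum V n \<omega> - (\<integral>x. psum V n x \<partial>M)) \<partial>M)) \<longlonglongrightarrow> 0"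
        by (rule tailsum_expectation_tendsto_0[OF L EN[OF L]]) }
    { assume nsum: "\<not> summable (\<lambda>n. tailsum a (Suc n)) \<and> (AE \<omega> in M. sumL a V \<omega> < \<infinity>)"
      then have "AE \<omega> in M. sumL a V \<omega> < \<infinity>" by blast
      then show "AE \<omega> in M. liminf (\<lambda>n. ereal (norm (psum V n \<omega>) / real n)) = 0"
        by eventually_elim (rule liminf_psum_eq_0[OF conjunct1[OF nsum]]) }
  qed
qed

end
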